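(* Let $(M^{d+l},g)$ be a CR-submanifold of an almost Hermitian manifold $(\bar M,\bar J,\bar g)$, and let $D=\bar J(TM)\cap TM$ be its maximal complex distribution, of real rank $d$. For any natural numbers $n_1,\ldots,n_k$ ($k\ge 2$, $n_i\ge 1$) such that $\sum_{i} n_i=s\le d$, the following inequality holds at every point of $M$: $$\delta^+_{\mathrm{m},D}(n_1,\ldots,n_k)\le \bar\delta^+_{\mathrm{m}}(n_1,\ldots,n_k)+\frac{k-1}{2k}\begin{cases}\mathcal{H}_{D}(s)^2, & \text{if } s<d,\\ \|H_{D}\|^2, & \text{if } s=d.\end{cases}$$ Equality holds at a point $x\in M$ if and only if there exist mutually orthogonal subspaces $V_1,\ldots,V_k$ of $D_x$ with $\dim V_i=n_i$ (so $\sum_i n_i=s$) such that $M$ is mixed totally geodesic on $V=\bigoplus_{i=1}^k V_i$, $H_1=\ldots=H_k$, $\|H_V\|=\mathcal{H}_{D_x}(s)$, and $\bar{\mathrm S}_{\mathrm{m}}(V_1,\ldots,V_k)=\bar\delta^+_{\mathrm{m}}(n_1,\ldots,n_k)(x)$.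
   Context: An almost Hermitian manifold $(\bar M,\bar J,\bar g)$ is an even-dimensional Riemannian manifold $(\bar M,\bar g)$ with a skew-symmetric $(1,1)$-tensor $\bar J$ such that $\bar J^2X=-X$ and $\bar g(\bar JX,\bar JY)=\bar g(X,Y)$ for all $X,Y\in T\bar M$. A submanifold $M^{d+l}$ ($d,l>0$) of $\bar M$ with the induced metric $g$ is a CR-submanifold if $D=\bar J(TM)\cap TM$ (the maximal $\bar J$-invariant subbundle of $TM$) is a distribution of constant real dimension $d$. Mutual curvature: with $R_{X,Y}=\nabla_X\nabla_Y-\nabla_Y\nabla_X-\nabla_{[X,Y]}$ the curvature tensor of $g$, for mutually orthogonal subspaces $V_1,\ldots,V_k$ ($k\ge2$) of $T_xM$ put $\mathrm{S}_{\mathrm{m}}(V_1,\ldots,V_k)=\sum_{i<j}\mathrm{S}_{\mathrm{m}}(V_i,V_j)$, where $\mathrm{S}_{\mathrm{m}}(V_i,V_j)=\sum_{a,b} g(R_{e_a,e_b}e_b,e_a)$, $\{e_a\}$ being an orthonormal basis of $V_i$ and $\{e_b\}$ an orthonormal basis of $V_j$ (independent of the choice of bases). $\bar{\mathrm S}_{\mathrm{m}}$ is the same quantity for $\bar g$, with the curvature tensor $\bar R$ of $\bar g$ and subspaces of $T_x\bar M$. Set $\delta^+_{\mathrm{m},D}(n_1,\ldots,n_k)(x)=\max \mathrm{S}_{\mathrm{m}}(V_1,\ldots,V_k)$, where $V_1,\ldots,V_k$ run over all mutually orthogonal subspaces of $D_x$ with $\dim V_i=n_i$. Set $\bar\delta^+_{\mathrm{m}}(n_1,\ldots,n_k)(x)=\max\bar{\mathrm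 S}_{\mathrm{m}}(V_1,\ldots,V_k)$, where $V_1,\ldots,V_k$ run over all mutually orthogonal subspaces of $T_x\bar M$ with $\dim V_i=n_i$. Extrinsic quantities: $h:TM\times TM\to TM^\perp$ is the second fundamental form of $M$ in $\bar M$. For a subspace $V\subset T_xM$ with orthonormal basis $\{e_i\}$, $H_V=\sum_i h(e_i,e_i)$ (no normalization); $H_i:=H_{V_i}$, and $H_D$ is the field $x\mapsto H_{D_x}$. For $0<s\le d$, $\mathcal{H}_{D_x}(s)=\max\{\|H_V\|: V\subset D_x,\ \dim V=s\}$, and $\mathcal{H}_D(s)$ denotes the function $x\mapsto\mathcal{H}_{D_x}(s)$; thus $\mathcal{H}_{D_x}(d)=\|H_{D_x}\|$. $M$ is mixed totally geodesic on $V=\bigoplus_{i=1}^kV_i\subset D_x$ if $h(X,Y)=0$ for all $X\in V_i$, $Y\in V_j$, $i\ne j$. *)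

theory Defs
  imports "HOL-Analysis.Analysis"
begin

section \<open>Smooth manifolds\<close>

(* Meant for open S only. *)
primrec Ck_on :: "nat \<Rightarrow> 'a::euclidean_space set \<Rightarrow> ('a \<Rightarrow> 'b::real_normed_vector) \<Rightarrow> bool" where
  "Ck_on 0 S f \<longleftrightarrow> continuous_on S f"
| "Ck_on (Suc k) S f \<longleftrightarrow> (\<forall>x\<in>S. f differentiable (at x)) \<and>
     (\<forall>v. Ck_on k S (\<lambda>x. frechet_derivative f (at x) v))"

definition smooth_on :: "'a::euclidean_space set \<Rightarrow> ('a \<Rightarrow> 'b::real_normed_vector) \<Rightarrow> bool" where
  "smooth_on S f \<longleftrightarrow> (\<forall>k. Ck_on k S f)"

type_synonym ('m, 'e) chart = "'m set \<times> ('m \<Rightarrow> 'e)"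

abbreviation chart_dom :: "('m, 'e) chart \<Rightarrow> 'm set" where
  "chart_dom c \<equiv> fst c"

abbreviation chart_map :: "('m, 'e) chart \<Rightarrow> 'm \<Rightarrow> 'e" where
  "chart_map c \<equiv> snd c"

definition chart_inv :: "('m, 'e) chart \<Rightarrow> 'e \<Rightarrow> 'm" where
  "chart_inv c = inv_into (chart_dom c) (chart_map c)"

definition is_chart :: "('m::topological_space, 'e::euclidean_space) chart \<Rightarrow> bool" where
  "is_chart c \<longleftrightarrow> open (chart_dom c) \<and> open (chart_map c ` chart_dom c) \<and>
     homeomorphism (chart_dom c) (chart_map c ` chart_dom c) (chart_map c) (chart_inv c)"

(* Besides the atlas, a manifold carries a chart "chart_at x" of the atlas around each point x.
   It serves to identify the tangent space at x with the model space 'e: the vector v :: 'e at x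
   stands for the tangent vector whose components in the chart "chart_at x" are v. Thus tensor
   fields are functions of the point with values in multilinear maps on 'e, and a statement about
   all manifolds holds for all choices of "chart_at", i.e. in all charts around a point. *)
record ('m, 'e) manifold =
  atlas :: "('m, 'e) chart set"
  chart_at :: "'m \<Rightarrow> ('m, 'e) chart"

definition points :: "('m, 'e) manifold \<Rightarrow> 'm set" where
  "points M = (\<Union>c\<in>atlas M. chart_dom c)"

definition smooth_manifold ::
    "('m::{t2_space,second_countable_topology}, 'e::euclidean_space) manifold \<Rightarrow> bool" where
  "smooth_manifold M \<longleftrightarrow>
     (\<forall>c\<in>atlas M. is_chart c) \<and>
     (\<forall>b\<in>atlas M. \<forall>c\<in>atlas M.
        smooth_on (chart_map b ` (chart_dom b \<inter> chart_dom c)) (chart_map c \<circ> chart_inv b)) \<and>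
     (\<forall>x\<in>points M. chart_at M x \<in> atlas M \<and> x \<in> chart_dom (chart_at M x))"

definition base_coord :: "('m, 'e) manifold \<Rightarrow> 'm \<Rightarrow> 'e" where
  "base_coord M x = chart_map (chart_at M x) x"

(* Passage between tangent vectors at x and their components in an arbitrary chart c around x. *)
definition to_comps ::
    "('m, 'e::euclidean_space) manifold \<Rightarrow> ('m, 'e) chart \<Rightarrow> 'm \<Rightarrow> 'e \<Rightarrow> 'e" where
  "to_comps M c x =
     frechet_derivative (chart_map c \<circ> chart_inv (chart_at M x)) (at (base_coord M x))"

definition of_comps ::
    "('m, 'e::euclidean_space) manifold \<Rightarrow> ('m, 'e) chart \<Rightarrow> 'm \<Rightarrow> 'e \<Rightarrow> 'e" where
  "of_comps M c x =
     frechet_derivative (chart_map (chart_at M x) \<circ> chart_inv c) (at (chart_map c x))"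

section \<open>Riemannian and almost Hermitian metrics\<close>

type_synonym ('m, 'e) metric_field = "'m \<Rightarrow> 'e \<Rightarrow> 'e \<Rightarrow> real"

definition metric_in ::
    "('m, 'e::euclidean_space) manifold \<Rightarrow> ('m, 'e) metric_field \<Rightarrow> ('m, 'e) chart
      \<Rightarrow> 'e \<Rightarrow> 'e \<Rightarrow> 'e \<Rightarrow> real" where
  "metric_in M g c p u v =
     g (chart_inv c p) (of_comps M c (chart_inv c p) u) (of_comps M c (chart_inv c p) v)"

definition riemannian_metric ::
    "('m, 'e::euclidean_space) manifold \<Rightarrow> ('m, 'e) metric_field \<Rightarrow> bool" where
  "riemannian_metric M g \<longleftrightarrow>
     (\<forall>x\<in>points M. bilinear (g x) \<and> (\<forall>u v. g x u v = g x v u) \<and> (\<forall>u. u \<noteq> 0 \<longrightarrow> g x u u > 0)) \<and>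
     (\<forall>c\<in>atlas M. \<forall>u v. smooth_on (chart_map c ` chart_dom c) (\<lambda>p. metric_in M g c p u v))"

definition smooth_endomorphism_field ::
    "('m, 'e::euclidean_space) manifold \<Rightarrow> ('m \<Rightarrow> 'e \<Rightarrow> 'e) \<Rightarrow> bool" where
  "smooth_endomorphism_field M J \<longleftrightarrow>
     (\<forall>x\<in>points M. linear (J x)) \<and>
     (\<forall>c\<in>atlas M. \<forall>u. smooth_on (chart_map c ` chart_dom c)
        (\<lambda>p. to_comps M c (chart_inv c p) (J (chart_inv c p) (of_comps M c (chart_inv c p) u))))"

definition almost_hermitian_manifold ::
    "('m::{t2_space,second_countable_topology}, 'e::euclidean_space) manifold
      \<Rightarrow> ('m \<Rightarrow> 'e \<Rightarrow> 'e) \<Rightarrow> ('m, 'e) metric_field \<Rightarrow> bool" where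
  "almost_hermitian_manifold M J g \<longleftrightarrow>
     smooth_manifold M \<and> even DIM('e) \<and> riemannian_metric M g \<and> smooth_endomorphism_field M J \<and>
     (\<forall>x\<in>points M. \<forall>u v. g x (J x u) v = - g x u (J x v) \<and> J x (J x u) = - u \<and>
        g x (J x u) (J x v) = g x u v)"

section \<open>Levi-Civita connection and curvature\<close>

abbreviation dir_deriv ::
    "('a::real_normed_vector \<Rightarrow> 'b::real_normed_vector) \<Rightarrow> 'a \<Rightarrow> 'a \<Rightarrow> 'b" where
  "dir_deriv f p u \<equiv> frechet_derivative f (at p) u"

(* In this section G is a Riemannian metric on an open set of 'e (a metric read in a chart).
   The Christoffel map is the value of the Levi-Civita connection on constant vector fields,
   given by the Koszul formula. *)
definition christoffel ::
    "('e::euclidean_space \<Rightarrow> 'e \<Rightarrow> 'e \<Rightarrow> real) \<Rightarrow> 'e \<Rightarrow> 'e \<Rightarrow> 'e \<Rightarrow> 'e" where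
  "christoffel G p u v = (THE w. \<forall>z. 2 * G p w z =
     dir_deriv (\<lambda>q. G q v z) p u + dir_deriv (\<lambda>q. G q u z) p v - dir_deriv (\<lambda>q. G q u v) p z)"

(* Covariant derivative at q in direction u of a vector field W along the map f, with respect
   to the pull-back by f of the Levi-Civita connection of G. *)
definition cov_along ::
    "('e::euclidean_space \<Rightarrow> 'e \<Rightarrow> 'e \<Rightarrow> real) \<Rightarrow> ('f::euclidean_space \<Rightarrow> 'e) \<Rightarrow> ('f \<Rightarrow> 'e)
      \<Rightarrow> 'f \<Rightarrow> 'f \<Rightarrow> 'e" where
  "cov_along G f W q u = dir_deriv W q u + christoffel G (f q) (dir_deriv f q u) (W q)"

definition nabla ::
    "('e::euclidean_space \<Rightarrow> 'e \<Rightarrow> 'e \<Rightarrow> real) \<Rightarrow> ('e \<Rightarrow> 'e) \<Rightarrow> ('e \<Rightarrow> 'e) \<Rightarrow> 'e \<Rightarrow> 'e" where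
  "nabla G X Y = (\<lambda>p. dir_deriv Y p (X p) + christoffel G p (X p) (Y p))"

definition lie_bracket ::
    "('e::euclidean_space \<Rightarrow> 'e) \<Rightarrow> ('e \<Rightarrow> 'e) \<Rightarrow> 'e \<Rightarrow> 'e" where
  "lie_bracket X Y = (\<lambda>p. dir_deriv Y p (X p) - dir_deriv X p (Y p))"

definition curvature_op ::
    "('e::euclidean_space \<Rightarrow> 'e \<Rightarrow> 'e \<Rightarrow> real) \<Rightarrow> ('e \<Rightarrow> 'e) \<Rightarrow> ('e \<Rightarrow> 'e) \<Rightarrow> ('e \<Rightarrow> 'e) \<Rightarrow> 'e \<Rightarrow> 'e" where
  "curvature_op G X Y Z = (\<lambda>p.
     nabla G X (nabla G Y Z) p - nabla G Y (nabla G X Z) p - nabla G (lie_bracket X Y) Z p)"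

(* R_{u,v} w at x. By tensoriality any extension of u, v, w to vector fields around x may be
   used; here they are extended with constant components in the chart at x. *)
definition curvature ::
    "('m, 'e::euclidean_space) manifold \<Rightarrow> ('m, 'e) metric_field \<Rightarrow> 'm \<Rightarrow> 'e \<Rightarrow> 'e \<Rightarrow> 'e \<Rightarrow> 'e" where
  "curvature M g x u v w =
     curvature_op (metric_in M g (chart_at M x)) (\<lambda>_. u) (\<lambda>_. v) (\<lambda>_. w) (base_coord M x)"

section \<open>Mutual curvature\<close>

definition orthonormal_basis ::
    "('e::euclidean_space \<Rightarrow> 'e \<Rightarrow> real) \<Rightarrow> 'e set \<Rightarrow> 'e set \<Rightarrow> bool" where
  "orthonormal_basis ip V B \<longleftrightarrow>
     finite B \<and> span B = V \<and> (\<forall>a\<in>B. \<forall>b\<in>B. ip a b = (if a = b then 1 else 0))"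

definition some_onb :: "('e::euclidean_space \<Rightarrow> 'e \<Rightarrow> real) \<Rightarrow> 'e set \<Rightarrow> 'e set" where
  "some_onb ip V = (SOME B. orthonormal_basis ip V B)"

definition mutual_curv2 ::
    "('m, 'e::euclidean_space) manifold \<Rightarrow> ('m, 'e) metric_field \<Rightarrow> 'm \<Rightarrow> 'e set \<Rightarrow> 'e set \<Rightarrow> real" where
  "mutual_curv2 M g x V W =
     (\<Sum>a\<in>some_onb (g x) V. \<Sum>b\<in>some_onb (g x) W. g x (curvature M g x a b b) a)"

(* The subspaces V_1, ..., V_k are indexed by 0, ..., k - 1. *)
definition mutual_curv ::
    "('m, 'e::euclidean_space) manifold \<Rightarrow> ('m, 'e) metric_field \<Rightarrow> 'm \<Rightarrow> nat \<Rightarrow> (nat \<Rightarrow> 'e set) \<Rightarrow> real" where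
  "mutual_curv M g x k V = (\<Sum>j<k. \<Sum>i<j. mutual_curv2 M g x (V i) (V j))"

definition orthogonal_subspaces ::
    "('e::euclidean_space \<Rightarrow> 'e \<Rightarrow> real) \<Rightarrow> 'e set \<Rightarrow> nat \<Rightarrow> (nat \<Rightarrow> nat) \<Rightarrow> (nat \<Rightarrow> 'e set) \<Rightarrow> bool" where
  "orthogonal_subspaces ip E k n V \<longleftrightarrow>
     (\<forall>i<k. subspace (V i) \<and> V i \<subseteq> E \<and> dim (V i) = n i) \<and>
     (\<forall>i<k. \<forall>j<k. i \<noteq> j \<longrightarrow> (\<forall>u\<in>V i. \<forall>v\<in>V j. ip u v = 0))"

definition delta_max_in ::
    "('m, 'e::euclidean_space) manifold \<Rightarrow> ('m, 'e) metric_field \<Rightarrow> 'm \<Rightarrow> 'e set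
      \<Rightarrow> nat \<Rightarrow> (nat \<Rightarrow> nat) \<Rightarrow> real" where
  "delta_max_in M g x E k n =
     (GREATEST r. \<exists>V. orthogonal_subspaces (g x) E k n V \<and> r = mutual_curv M g x k V)"

abbreviation delta_max ::
    "('m, 'e::euclidean_space) manifold \<Rightarrow> ('m, 'e) metric_field \<Rightarrow> 'm
      \<Rightarrow> nat \<Rightarrow> (nat \<Rightarrow> nat) \<Rightarrow> real" where
  "delta_max M g x k n \<equiv> delta_max_in M g x UNIV k n"

section \<open>CR-submanifolds and their second fundamental form\<close>

(* A submanifold is given by an immersion F of M into N; the inclusion is the case of a subset.
   T_x M is identified with its image under the differential of F. *)

definition local_rep ::
    "('m, 'f) manifold \<Rightarrow> ('n, 'e) manifold \<Rightarrow> ('m \<Rightarrow> 'n) \<Rightarrow> 'm \<Rightarrow> 'f \<Rightarrow> 'e" where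
  "local_rep M N F x = chart_map (chart_at N (F x)) \<circ> F \<circ> chart_inv (chart_at M x)"

definition differential ::
    "('m, 'f::euclidean_space) manifold \<Rightarrow> ('n, 'e::euclidean_space) manifold \<Rightarrow> ('m \<Rightarrow> 'n)
      \<Rightarrow> 'm \<Rightarrow> 'f \<Rightarrow> 'e" where
  "differential M N F x = frechet_derivative (local_rep M N F x) (at (base_coord M x))"

definition smooth_map ::
    "('m::topological_space, 'f::euclidean_space) manifold
      \<Rightarrow> ('n::topological_space, 'e::euclidean_space) manifold \<Rightarrow> ('m \<Rightarrow> 'n) \<Rightarrow> bool" where
  "smooth_map M N F \<longleftrightarrow> F ` points M \<subseteq> points N \<and> continuous_on (points M) F \<and>
     (\<forall>b\<in>atlas M. \<forall>c\<in>atlas N. smooth_on (chart_map b ` {x \<in> chart_dom b. F x \<in> chart_dom c})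
        (chart_map c \<circ> F \<circ> chart_inv b))"

definition immersion ::
    "('m::topological_space, 'f::euclidean_space) manifold
      \<Rightarrow> ('n::topological_space, 'e::euclidean_space) manifold \<Rightarrow> ('m \<Rightarrow> 'n) \<Rightarrow> bool" where
  "immersion M N F \<longleftrightarrow> smooth_map M N F \<and> (\<forall>x\<in>points M. inj (differential M N F x))"

definition induced_metric ::
    "('m, 'f::euclidean_space) manifold \<Rightarrow> ('n, 'e::euclidean_space) manifold
      \<Rightarrow> ('n, 'e) metric_field \<Rightarrow> ('m \<Rightarrow> 'n) \<Rightarrow> ('m, 'f) metric_field" where
  "induced_metric M N gbar F x u v = gbar (F x) (differential M N F x u) (differential M N F x v)"

definition max_complex_dist ::
    "('m, 'f::euclidean_space) manifold \<Rightarrow> ('n, 'e::euclidean_space) manifold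
      \<Rightarrow> ('n \<Rightarrow> 'e \<Rightarrow> 'e) \<Rightarrow> ('m \<Rightarrow> 'n) \<Rightarrow> 'm \<Rightarrow> 'f set" where
  "max_complex_dist M N J F x =
     {u. differential M N F x u \<in> J (F x) ` range (differential M N F x)}"

definition cr_submanifold ::
    "('m::{t2_space,second_countable_topology}, 'f::euclidean_space) manifold
      \<Rightarrow> ('n::{t2_space,second_countable_topology}, 'e::euclidean_space) manifold
      \<Rightarrow> ('n \<Rightarrow> 'e \<Rightarrow> 'e) \<Rightarrow> ('m \<Rightarrow> 'n) \<Rightarrow> nat \<Rightarrow> nat \<Rightarrow> bool" where
  "cr_submanifold M N J F d l \<longleftrightarrow>
     smooth_manifold M \<and> immersion M N F \<and> DIM('f) = d + l \<and> 0 < d \<and> 0 < l \<and>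
     (\<forall>x\<in>points M. dim (max_complex_dist M N J F x) = d)"

definition normal_part ::
    "('e::euclidean_space \<Rightarrow> 'e \<Rightarrow> real) \<Rightarrow> 'e set \<Rightarrow> 'e \<Rightarrow> 'e" where
  "normal_part ip S w = (THE z. (\<forall>y\<in>S. ip z y = 0) \<and> w - z \<in> S)"

(* h(u, v) is the normal part of the ambient covariant derivative of the vector field dF(v)
   along F, where v is extended with constant components in the chart at x. *)
definition second_ff ::
    "('m, 'f::euclidean_space) manifold \<Rightarrow> ('n, 'e::euclidean_space) manifold
      \<Rightarrow> ('n, 'e) metric_field \<Rightarrow> ('m \<Rightarrow> 'n) \<Rightarrow> 'm \<Rightarrow> 'f \<Rightarrow> 'f \<Rightarrow> 'e" where
  "second_ff M N gbar F x u v =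
     normal_part (gbar (F x)) (range (differential M N F x))
       (cov_along (metric_in N gbar (chart_at N (F x))) (local_rep M N F x)
          (\<lambda>q. dir_deriv (local_rep M N F x) q v) (base_coord M x) u)"

(* H_V, without normalization *)
definition mean_curv ::
    "('m, 'f::euclidean_space) manifold \<Rightarrow> ('n, 'e::euclidean_space) manifold
      \<Rightarrow> ('n, 'e) metric_field \<Rightarrow> ('m \<Rightarrow> 'n) \<Rightarrow> 'm \<Rightarrow> 'f set \<Rightarrow> 'e" where
  "mean_curv M N gbar F x V =
     (\<Sum>a\<in>some_onb (induced_metric M N gbar F x) V. second_ff M N gbar F x a a)"

definition metric_norm :: "('n, 'e) metric_field \<Rightarrow> 'n \<Rightarrow> 'e \<Rightarrow> real" where
  "metric_norm g y w = sqrt (g y w w)"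

definition max_mean_curv ::
    "('m, 'f::euclidean_space) manifold \<Rightarrow> ('n, 'e::euclidean_space) manifold
      \<Rightarrow> ('n, 'e) metric_field \<Rightarrow> ('m \<Rightarrow> 'n) \<Rightarrow> 'm \<Rightarrow> 'f set \<Rightarrow> nat \<Rightarrow> real" where
  "max_mean_curv M N gbar F x E s =
     (GREATEST r. \<exists>V. subspace V \<and> V \<subseteq> E \<and> dim V = s \<and>
        r = metric_norm gbar (F x) (mean_curv M N gbar F x V))"

definition mixed_totally_geodesic ::
    "('m, 'f::euclidean_space) manifold \<Rightarrow> ('n, 'e::euclidean_space) manifold
      \<Rightarrow> ('n, 'e) metric_field \<Rightarrow> ('m \<Rightarrow> 'n) \<Rightarrow> 'm \<Rightarrow> nat \<Rightarrow> (nat \<Rightarrow> 'f set) \<Rightarrow> bool" where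
  "mixed_totally_geodesic M N gbar F x k V \<longleftrightarrow>
     (\<forall>i<k. \<forall>j<k. i \<noteq> j \<longrightarrow> (\<forall>u\<in>V i. \<forall>v\<in>V j. second_ff M N gbar F x u v = 0))"

end

(*
  In a chart the immersion f pulls the ambient metric back, and the ambient covariant derivative
  A(u, v) of df(v) in direction u splits into df of the Christoffel map of the induced metric and the
  normal part h(u, v). Differentiating <A(v, w), df z> in two ways and antisymmetrising gives the
  Gauss equation. Summing it over orthonormal bases of V_1, ..., V_k yields

    S_m(V_1..V_k) = Sbar_m(V_1..V_k) + (k-1)/(2k) |H_V|^2
                      - 1/(2k) sum_{i<j} |H_i - H_j|^2 - sum_{i<j} |h restricted to V_i x V_j|^2,

  because sum_{i<j} <H_i, H_j> differs from (k-1)/(2k) |H_1 + ... + H_k|^2 by that sum of squares.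
  Both the inequality and its equality case can be read off, as all the maxima are attained: they are
  maxima of continuous functions on the compact set of orthonormal frames.
*)

theory Submission
  imports Defs
begin

section \<open>Inner products and orthonormal bases\<close>

text \<open>Three descriptions in the definitions have to be made usable. Bases come from
  \<open>SOME\<close>, so each trace must be shown independent of the orthonormal basis. The delta
  invariants are \<open>GREATEST\<close> values, which say nothing unless attained; attainment is
  also what turns the equality case into an existence statement about subspaces. The Christoffel map
  is a \<open>THE\<close> value, the solution of a linear system depending on the point, and its
  differentiability, needed for the curvature, has to be extracted from that system. A further
  obstacle: tangent vectors at each point are read in that point's own \<open>chart_at\<close>, so a
  field near x can be differentiated only after transport to one fixed chart; the chain rule shows
  that dF is compatible with this transport. The induced metric is given pointwise only. That its
  coefficients can be differentiated twice follows by writing their first derivatives as ambient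
  pairings of df with its covariant derivatives. Geometry and algebra meet in the locale
  \<open>gauss_data\<close>, which keeps of the immersion at a point only multilinear maps and the
  Gauss equation.\<close>

locale inner_form =
  fixes ip :: "'a::euclidean_space \<Rightarrow> 'a \<Rightarrow> real"
  assumes bilin: "bilinear ip"
    and sym: "ip u v = ip v u"
    and pos: "u \<noteq> 0 \<Longrightarrow> 0 < ip u u"
begin

lemmas simps = bilinear_ladd[OF bilin] bilinear_radd[OF bilin] bilinear_lsub[OF bilin]
  bilinear_rsub[OF bilin] bilinear_lmul[OF bilin] bilinear_rmul[OF bilin]
  bilinear_lzero[OF bilin] bilinear_rzero[OF bilin] bilinear_lneg[OF bilin] bilinear_rneg[OF bilin]

lemma nonneg: "0 \<le> ip u u"
  using pos[of u] by (cases "u = 0") (auto simp: simps)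

lemma eq_0_iff: "ip u u = 0 \<longleftrightarrow> u = 0"
  using pos[of u] by (cases "u = 0") (auto simp: simps)

lemma linear_left: "linear (\<lambda>u. ip u v)"
  using bilin by (simp add: bilinear_def)

lemma linear_right: "linear (ip v)"
  using bilin by (simp add: bilinear_def)

lemma sum_left: "ip (\<Sum>i\<in>I. f i) v = (\<Sum>i\<in>I. ip (f i) v)"
  using linear_sum[OF linear_left] .

lemma sum_right: "ip v (\<Sum>i\<in>I. f i) = (\<Sum>i\<in>I. ip v (f i))"
  using linear_sum[OF linear_right] .

lemma eqI: "u = v" if "\<And>z. ip u z = ip v z"
proof -
  have "ip (u - v) (u - v) = 0"
    using that by (simp add: simps)
  then show ?thesis
    by (simp add: eq_0_iff)
qed

section \<open>Orthonormal bases, traces and orthogonal projection\<close>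

lemma ip_orthonormal_sum:
  assumes "finite B" "\<forall>a\<in>B. \<forall>b\<in>B. ip a b = (if a = b then 1 else 0)" "b \<in> B"
  shows "ip (\<Sum>a\<in>B. c a *\<^sub>R a) b = c b"
proof -
  have "ip (\<Sum>a\<in>B. c a *\<^sub>R a) b = (\<Sum>a\<in>B. if a = b then c a else 0)"
    unfolding sum_left by (rule sum.cong) (use assms in \<open>auto simp: simps\<close>)
  then show ?thesis
    using assms by simp
qed

lemma orthonormal_independent:
  assumes "finite B" "\<forall>a\<in>B. \<forall>b\<in>B. ip a b = (if a = b then 1 else 0)"
  shows "independent B"
  unfolding independent_explicit
proof (intro conjI allI impI ballI)
  fix c b assume "(\<Sum>v\<in>B. c v *\<^sub>R v) = 0" "b \<in> B"
  then show "c b = 0"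
    using ip_orthonormal_sum[OF assms, of b c] by (simp add: simps)
qed (rule assms)

lemma onb_dim: "orthonormal_basis ip V B \<Longrightarrow> card B = dim V"
  unfolding orthonormal_basis_def using orthonormal_independent dim_eq_card_independent dim_span
  by force

lemma onb_span: "orthonormal_basis ip V B \<Longrightarrow> span B = V"
  by (simp add: orthonormal_basis_def)

lemma onb_finite: "orthonormal_basis ip V B \<Longrightarrow> finite B"
  by (simp add: orthonormal_basis_def)

lemma onb_mem: "orthonormal_basis ip V B \<Longrightarrow> b \<in> B \<Longrightarrow> b \<in> V"
  by (auto simp: orthonormal_basis_def intro: span_base)

lemma onb_expand:
  assumes "orthonormal_basis ip V B" "v \<in> V"
  shows "v = (\<Sum>b\<in>B. ip v b *\<^sub>R b)"
proof -
  have fin: "finite B" and on: "\<forall>a\<in>B. \<forall>b\<in>B. ip a b = (if a = b then 1 else 0)" and "v \<in> span B"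
    using assms by (auto simp: orthonormal_basis_def)
  then obtain c where "v = (\<Sum>b\<in>B. c b *\<^sub>R b)"
    by (auto simp: span_finite)
  then show ?thesis
    using ip_orthonormal_sum[OF fin on, of _ c] by (auto intro!: sum.cong)
qed

text \<open>Gram-Schmidt by induction on the dimension: one nonzero vector is normalised, and the
  induction hypothesis handles its orthogonal complement in \<open>V\<close>.\<close>

lemma onb_exists: "subspace V \<Longrightarrow> \<exists>B. orthonormal_basis ip V B"
proof (induction "dim V" arbitrary: V rule: less_induct)
  case less
  show ?case
  proof (cases "V \<subseteq> {0}")
    case True
    then have "span {} = V"
      using less.prems subspace_0 by auto
    then show ?thesis
      by (auto simp: orthonormal_basis_def intro!: exI[of _ "{}"])
  next
    case False
    then obtain w where w: "w \<in> V" "w \<noteq> 0"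
      by blast
    define u where "u = (1 / sqrt (ip w w)) *\<^sub>R w"
    have u: "u \<in> V" "ip u u = 1"
      using w pos[OF w(2)] less.prems
      by (auto simp: u_def simps subspace_scale real_sqrt_mult[symmetric] field_simps)
    define W where "W = {v \<in> V. ip u v = 0}"
    have W: "subspace W"
      using less.prems unfolding W_def subspace_def by (auto simp: simps)
    have "W \<subset> V"
      using u unfolding W_def by force
    then have "dim W < dim V"
      using less.prems W by (metis dim_psubset span_eq_iff)
    then obtain B where B: "orthonormal_basis ip W B"
      using less.hyps W by blast
    have perp: "ip u b = 0 \<and> ip b u = 0" if "b \<in> B" for b
      using onb_mem[OF B that] sym[of b u] by (auto simp: W_def)
    have "span (insert u B) = V"
    proof
      show "span (insert u B) \<subseteq> V"
        using u onb_mem[OF B] less.prems by (intro span_minimal) (auto simp: W_def)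
      show "V \<subseteq> span (insert u B)"
      proof
        fix v assume "v \<in> V"
        then have "v - ip u v *\<^sub>R u \<in> W"
          using u less.prems by (auto simp: W_def simps subspace_diff subspace_scale)
        then show "v \<in> span (insert u B)"
          unfolding onb_span[OF B, symmetric] span_insert by blast
      qed
    qed
    then have "orthonormal_basis ip V (insert u B)"
      using B u perp by (auto simp: orthonormal_basis_def)
    then show ?thesis by blast
  qed
qed

lemma some_onb: "subspace V \<Longrightarrow> orthonormal_basis ip V (some_onb ip V)"
  unfolding some_onb_def using onb_exists by (rule someI_ex)

text \<open>The coefficients of \<open>A\<close> with respect to \<open>B\<close> form an orthogonal
  matrix, so expanding every \<open>a\<close> in \<open>B\<close> leaves only the diagonal terms.
  Values in any real vector space are allowed because the lemma serves both the vector-valued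
  \<open>h\<close> and the real curvature sums.\<close>

lemma onb_trace_eq:
  fixes \<beta> :: "'a \<Rightarrow> 'a \<Rightarrow> 'b::real_vector"
  assumes A: "orthonormal_basis ip V A" and B: "orthonormal_basis ip V B" and \<beta>: "bilinear \<beta>"
  shows "(\<Sum>a\<in>A. \<beta> a a) = (\<Sum>b\<in>B. \<beta> b b)"
proof -
  have \<beta>sum: "\<beta> (\<Sum>b\<in>B. f b *\<^sub>R b) (\<Sum>b\<in>B. g b *\<^sub>R b) = (\<Sum>b\<in>B. \<Sum>c\<in>B. (f b * g c) *\<^sub>R \<beta> b c)"
    for f g
  proof -
    have "linear (\<lambda>u. \<beta> u v)" "linear (\<beta> v)" for v
      using \<beta> by (auto simp: bilinear_def)
    then show ?thesis
      by (simp add: linear_sum[where f = "\<lambda>u. \<beta> u _"] linear_sum[where f = "\<beta> _"]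
          bilinear_lmul[OF \<beta>] bilinear_rmul[OF \<beta>] scaleR_sum_right mult.commute)
        (rule sum.swap)
  qed
  \<comment> \<open>Orthogonality of that matrix: expanding \<open>b\<close> in the other basis
    \<open>A\<close> turns the sum into \<open>ip b c\<close>.\<close>
  have coeff: "(\<Sum>a\<in>A. ip a b * ip a c) = (if b = c then 1 else 0)" if "b \<in> B" "c \<in> B" for b c
  proof -
    have "ip b c = ip (\<Sum>a\<in>A. ip b a *\<^sub>R a) c"
      by (subst onb_expand[OF A onb_mem[OF B that(1)]]) simp
    then show ?thesis
      using that B sym[of b] unfolding sum_left orthonormal_basis_def
      by (cases "b = c") (simp_all add: simps)
  qed
  have "(\<Sum>a\<in>A. \<beta> a a) = (\<Sum>a\<in>A. \<Sum>b\<in>B. \<Sum>c\<in>B. (ip a b * ip a c) *\<^sub>R \<beta> b c)"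
  proof (rule sum.cong[OF refl])
    fix a assume "a \<in> A"
    note a = onb_expand[OF B onb_mem[OF A this]]
    have "\<beta> a a = \<beta> (\<Sum>b\<in>B. ip a b *\<^sub>R b) (\<Sum>b\<in>B. ip a b *\<^sub>R b)"
      using arg_cong2[OF a a, of \<beta>] .
    then show "\<beta> a a = (\<Sum>b\<in>B. \<Sum>c\<in>B. (ip a b * ip a c) *\<^sub>R \<beta> b c)"
      by (simp only: \<beta>sum)
  qed
  also have "\<dots> = (\<Sum>b\<in>B. \<Sum>c\<in>B. (\<Sum>a\<in>A. ip a b * ip a c) *\<^sub>R \<beta> b c)"
    unfolding scaleR_sum_left
    by (subst sum.swap) (rule sum.cong[OF refl], rule sum.swap)
  also have "\<dots> = (\<Sum>b\<in>B. \<Sum>c\<in>B. if b = c then \<beta> b c else 0)"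
    using coeff by (auto intro!: sum.cong)
  also have "\<dots> = (\<Sum>b\<in>B. \<beta> b b)"
    using onb_finite[OF B] by simp
  finally show ?thesis .
qed

text \<open>The values of \<open>L\<close> on an orthonormal basis are the coefficients of the
  representing vector. This is what makes the \<open>THE\<close> in \<open>christoffel\<close> well
  defined.\<close>

lemma ex1_riesz:
  assumes "linear L"
  shows "\<exists>!w. \<forall>z. ip w z = L z"
proof (rule ex_ex1I)
  obtain B where B: "orthonormal_basis ip UNIV B"
    using onb_exists subspace_UNIV by blast
  have "ip (\<Sum>b\<in>B. L b *\<^sub>R b) z = L z" for z
  proof -
    have "L z = (\<Sum>b\<in>B. ip z b * L b)"
      by (subst onb_expand[OF B, of z]) (simp_all add: linear_sum[OF assms] linear_scale[OF assms])
    then show ?thesis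
      by (simp add: sum_left simps sym[of z] mult.commute)
  qed
  then show "\<exists>w. \<forall>z. ip w z = L z" by blast
qed (auto intro: eqI)

text \<open>Projecting along an orthonormal basis of \<open>S\<close> gives the witness
  \<open>w - t\<close>; two candidates differ by a vector of \<open>S\<close> that is orthogonal to
  itself. This justifies the \<open>THE\<close> in \<open>normal_part\<close>.\<close>

lemma ex1_normal_part:
  assumes "subspace S"
  shows "\<exists>!z. (\<forall>y\<in>S. ip z y = 0) \<and> w - z \<in> S"
proof (rule ex_ex1I)
  obtain B where B: "orthonormal_basis ip S B"
    using onb_exists assms by blast
  define t where "t = (\<Sum>b\<in>B. ip w b *\<^sub>R b)"
  have "t \<in> S"
    unfolding t_def using assms onb_mem[OF B] by (auto intro: subspace_sum subspace_scale)
  have "ip (w - t) b = 0" if "b \<in> B" for b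
    using ip_orthonormal_sum[OF _ _ that, of "\<lambda>a. ip w a"] B
    by (simp add: t_def simps orthonormal_basis_def)
  then have "ip (w - t) y = 0" if "y \<in> S" for y
    by (subst onb_expand[OF B that]) (simp add: sum_right simps)
  with \<open>t \<in> S\<close> show "\<exists>z. (\<forall>y\<in>S. ip z y = 0) \<and> w - z \<in> S"
    by (intro exI[of _ "w - t"]) auto
next
  fix z z' assume z: "(\<forall>y\<in>S. ip z y = 0) \<and> w - z \<in> S" and z': "(\<forall>y\<in>S. ip z' y = 0) \<and> w - z' \<in> S"
  have "z - z' \<in> S"
    using subspace_diff[OF assms, of "w - z'" "w - z"] z z' by simp
  with z z' have "ip z (z - z') = 0" "ip z' (z - z') = 0"
    by blast+
  then have "ip (z - z') (z - z') = 0"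
    by (simp add: simps)
  then show "z = z'"
    by (simp add: eq_0_iff)
qed

lemma normal_part:
  assumes "subspace S"
  shows "y \<in> S \<Longrightarrow> ip (normal_part ip S w) y = 0" "w - normal_part ip S w \<in> S"
  using theI'[OF ex1_normal_part[OF assms, of w]] by (auto simp: normal_part_def)

lemma normal_part_eqI:
  assumes "subspace S" "\<And>y. y \<in> S \<Longrightarrow> ip z y = 0" "w - z \<in> S"
  shows "normal_part ip S w = z"
  using ex1_normal_part[OF assms(1), of w] normal_part[OF assms(1), where w = w] assms(2,3) by blast

lemma linear_normal_part:
  assumes "subspace S"
  shows "linear (normal_part ip S)"
proof (rule linearI)
  note np = normal_part[OF assms]
  show "normal_part ip S (v + w) = normal_part ip S v + normal_part ip S w" for v w
  proof (rule normal_part_eqI[OF assms])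
    show "v + w - (normal_part ip S v + normal_part ip S w) \<in> S"
      using subspace_add[OF assms np(2)[of v] np(2)[of w]] by (simp add: algebra_simps)
  qed (simp add: simps np)
  show "normal_part ip S (r *\<^sub>R w) = r *\<^sub>R normal_part ip S w" for r w
  proof (rule normal_part_eqI[OF assms])
    show "r *\<^sub>R w - r *\<^sub>R normal_part ip S w \<in> S"
      using subspace_scale[OF assms np(2)[of w], of r] by (simp add: algebra_simps)
  qed (simp add: simps np)
qed

text \<open>A frame is a total function on the index type, forced to be 0 off \<open>I\<close>, so
  that frames form a subset of a full function space with its product topology. The free index type
  admits pairs as indices later.\<close>

definition frames :: "'a set \<Rightarrow> 'i set \<Rightarrow> ('i \<Rightarrow> 'a) set" where
  "frames E I = {e. (\<forall>i. i \<in> I \<longrightarrow> e i \<in> E) \<and> (\<forall>i. i \<notin> I \<longrightarrow> e i = 0) \<and>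
     (\<forall>i j. i \<in> I \<longrightarrow> j \<in> I \<longrightarrow> ip (e i) (e j) = (if i = j then 1 else 0))}"

lemma frames_ip: "e \<in> frames E I \<Longrightarrow> i \<in> I \<Longrightarrow> j \<in> I \<Longrightarrow> ip (e i) (e j) = (if i = j then 1 else 0)"
  by (simp add: frames_def)

lemma frames_mem: "e \<in> frames E I \<Longrightarrow> i \<in> I \<Longrightarrow> e i \<in> E"
  by (simp add: frames_def)

lemma continuous_on_ip: "continuous_on S f \<Longrightarrow> continuous_on S g \<Longrightarrow> continuous_on S (\<lambda>x. ip (f x) (g x))"
  using bilin unfolding bilinear_conv_bounded_bilinear by (rule bounded_bilinear.continuous_on)

text \<open>The norm of the model space is unrelated to \<open>ip\<close>. By Parseval each
  coordinate of an \<open>ip\<close>-unit vector in an orthonormal basis is at most 1 in absolute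
  value, hence the bound by the sum of the norms of the basis vectors.\<close>

lemma unit_vectors_bounded: "\<exists>r. \<forall>u. ip u u = 1 \<longrightarrow> norm u \<le> r"
proof -
  obtain B where B: "orthonormal_basis ip UNIV B"
    using onb_exists subspace_UNIV by blast
  have "norm u \<le> (\<Sum>b\<in>B. norm b)" if "ip u u = 1" for u
  proof -
    have "ip u u = ip (\<Sum>b\<in>B. ip u b *\<^sub>R b) u"
      by (subst (1) onb_expand[OF B, of u]) simp_all
    also have "\<dots> = (\<Sum>b\<in>B. (ip u b)\<^sup>2)"
      unfolding sum_left power2_eq_square by (rule sum.cong[OF refl]) (simp add: simps sym)
    finally have eq: "(\<Sum>b\<in>B. (ip u b)\<^sup>2) = 1"
      using that by simp
    have le: "\<bar>ip u b\<bar> \<le> 1" if "b \<in> B" for b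
    proof -
      have "(ip u b)\<^sup>2 \<le> (\<Sum>b\<in>B. (ip u b)\<^sup>2)"
        using that onb_finite[OF B] by (intro member_le_sum) auto
      then show ?thesis
        using eq by (simp add: abs_square_le_1)
    qed
    have "norm u = norm (\<Sum>b\<in>B. ip u b *\<^sub>R b)"
      by (subst onb_expand[OF B, of u]) simp_all
    also have "\<dots> \<le> (\<Sum>b\<in>B. \<bar>ip u b\<bar> * norm b)"
      by (rule sum_norm_le) simp
    also have "\<dots> \<le> (\<Sum>b\<in>B. norm b)"
      using le by (intro sum_mono) (simp add: mult_left_le_one_le)
    finally show ?thesis .
  qed
  then show ?thesis by blast
qed

text \<open>Frames are cut out by closed conditions on coordinates inside a product of closed balls,
  which is compact by Tychonoff.\<close>

lemma compact_frames:
  fixes I :: "'i set"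
  assumes "subspace E"
  shows "compact (frames E I)"
proof -
  obtain r where r: "\<And>u. ip u u = 1 \<Longrightarrow> norm u \<le> r"
    using unit_vectors_bounded by blast
  \<comment> \<open>The radius \<open>max r 0\<close> keeps 0, the value of a frame off
    \<open>I\<close>, inside the ball.\<close>
  have "compactin (product_topology (\<lambda>_. euclidean) UNIV) (PiE UNIV (\<lambda>_. cball 0 (max r 0) :: 'a set))"
    unfolding compactin_PiE by auto
  then have cmp: "compact {e. \<forall>i. e i \<in> cball (0::'a) (max r 0)}"
    by (simp add: euclidean_product_topology PiE_UNIV_domain Pi_def compactin_euclidean_iff)
  have clE: "closed E"
    by (rule closed_subspace[OF assms])
  have coord: "continuous_on UNIV (\<lambda>e :: 'i \<Rightarrow> 'a. e i)" for i
    by (rule continuous_on_product_coordinates)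
  have "closed {e :: 'i \<Rightarrow> 'a. e i \<in> E}" "closed {e :: 'i \<Rightarrow> 'a. e i = 0}"
    "closed {e. ip (e i) (e j) = c}" for i j c
    using closed_vimage[OF clE coord] closed_Collect_eq[OF coord continuous_on_const]
      closed_Collect_eq[OF continuous_on_ip[OF coord coord] continuous_on_const]
    by (auto simp: vimage_def)
  then have "closed ((\<Inter>i\<in>I. {e :: 'i \<Rightarrow> 'a. e i \<in> E}) \<inter> (\<Inter>i\<in>-I. {e. e i = 0}) \<inter>
      (\<Inter>i\<in>I. \<Inter>j\<in>I. {e. ip (e i) (e j) = (if i = j then 1 else 0)}))"
    by (intro closed_Int closed_INT ballI)
  also have "\<dots> = frames E I"
    by (auto simp: frames_def)
  finally have "closed (frames E I)" .
  moreover have "frames E I \<subseteq> {e. \<forall>i. e i \<in> cball 0 (max r 0)}"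
  proof
    fix e assume e: "e \<in> frames E I"
    have "norm (e i) \<le> max r 0" for i
      using e r[of "e i"] by (cases "i \<in> I") (auto simp: frames_def)
    then show "e \<in> {e. \<forall>i. e i \<in> cball 0 (max r 0)}" by simp
  qed
  ultimately show ?thesis
    using compact_Int_closed[OF cmp, of "frames E I"] by (simp add: Int_absorb1)
qed

lemma frames_nonempty:
  assumes "subspace E" "finite I" "card I \<le> dim E"
  shows "frames E I \<noteq> {}"
proof -
  obtain B where B: "orthonormal_basis ip E B"
    using onb_exists assms by blast
  then obtain f where f: "f ` I \<subseteq> B" "inj_on f I"
    using assms onb_dim[OF B] onb_finite[OF B] by (metis card_le_inj)
  have "(\<lambda>i. if i \<in> I then f i else 0) \<in> frames E I"
    using f B onb_mem[OF B] by (auto simp: frames_def orthonormal_basis_def inj_on_def image_subset_iff)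
  then show ?thesis by blast
qed

lemma frames_attains_max:
  fixes \<Phi> :: "('i \<Rightarrow> 'a) \<Rightarrow> real"
  assumes "subspace E" "finite I" "card I \<le> dim E" "continuous_on UNIV \<Phi>"
  shows "\<exists>e\<in>frames E I. \<forall>e'\<in>frames E I. \<Phi> e' \<le> \<Phi> e"
  using continuous_attains_sup[OF compact_frames frames_nonempty] assms continuous_on_subset by blast

lemma frame_onb:
  assumes "e \<in> frames E I" "I' \<subseteq> I" "finite I'"
  shows "orthonormal_basis ip (span (e ` I')) (e ` I')" "inj_on e I'"
proof -
  show inj: "inj_on e I'"
  proof (rule inj_onI)
    fix i j assume "i \<in> I'" "j \<in> I'" "e i = e j"
    moreover have "i \<in> I" "j \<in> I"
      using calculation assms by auto
    ultimately show "i = j"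
      using frames_ip[OF assms(1), of i j] frames_ip[OF assms(1), of j j] by (simp split: if_splits)
  qed
  show "orthonormal_basis ip (span (e ` I')) (e ` I')"
    unfolding orthonormal_basis_def
  proof (intro conjI ballI refl finite_imageI assms)
    fix a b assume "a \<in> e ` I'" "b \<in> e ` I'"
    then obtain i j where "i \<in> I'" "j \<in> I'" "a = e i" "b = e j"
      by blast
    then show "ip a b = (if a = b then 1 else 0)"
      using assms(2) frames_ip[OF assms(1), of i j] inj by (auto simp: inj_on_def subset_iff)
  qed
qed

lemma card_frame_dim:
  assumes "e \<in> frames E I" "I' \<subseteq> I" "finite I'"
  shows "dim (span (e ` I')) = card I'"
  using onb_dim[OF frame_onb(1)[OF assms]] card_image[OF frame_onb(2)[OF assms]] by simp

text \<open>Enumerates a given basis by the index set. Together with \<open>frame_onb\<close> it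
  lets a maximum over frames stand for a maximum over subspaces.\<close>

lemma onb_frame:
  assumes B: "orthonormal_basis ip V B" and "V \<subseteq> E" "finite I" "card I = dim V"
  obtains e where "e \<in> frames E I" "bij_betw e I B"
proof -
  obtain f where f: "bij_betw f I B"
    using assms onb_dim[OF B] onb_finite[OF B] by (metis finite_same_card_bij)
  define e where "e = (\<lambda>i. if i \<in> I then f i else 0)"
  have bij: "bij_betw e I B"
    using f by (auto simp: e_def cong: bij_betw_cong)
  have inB: "e i \<in> B" if "i \<in> I" for i
    using bij that bij_betwE by blast
  have "e \<in> frames E I"
    unfolding frames_def
  proof (intro CollectI conjI allI impI)
    fix i j assume "i \<in> I" "j \<in> I"
    then show "ip (e i) (e j) = (if i = j then 1 else 0)"
      using B inB bij by (auto simp: orthonormal_basis_def bij_betw_def inj_on_def)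
  qed (use inB onb_mem[OF B] assms in \<open>auto simp: e_def\<close>)
  then show ?thesis
    using bij that by blast
qed

end

section \<open>Mutual curvature of an algebraic curvature form\<close>

definition quadrilinear :: "('a::real_vector \<Rightarrow> 'a \<Rightarrow> 'a \<Rightarrow> 'a \<Rightarrow> real) \<Rightarrow> bool" where
  "quadrilinear T \<longleftrightarrow> (\<forall>v w z. linear (\<lambda>u. T u v w z)) \<and> (\<forall>u w z. linear (\<lambda>v. T u v w z)) \<and>
     (\<forall>u v z. linear (\<lambda>w. T u v w z)) \<and> (\<forall>u v w. linear (\<lambda>z. T u v w z))"

lemma linear_basis_expand:
  fixes L :: "'a::euclidean_space \<Rightarrow> 'b::real_vector"
  assumes "linear L"
  shows "L u = (\<Sum>i\<in>Basis. (u \<bullet> i) *\<^sub>R L i)"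
  by (subst euclidean_representation[of u, symmetric])
    (simp add: linear_sum[OF assms] linear_scale[OF assms])

text \<open>The slots are expanded in the standard basis one at a time, from the last to the first,
  so that only finite sums of products of continuous functions occur.\<close>

lemma continuous_on_quadrilinear:
  fixes T :: "'a::euclidean_space \<Rightarrow> 'a \<Rightarrow> 'a \<Rightarrow> 'a \<Rightarrow> real"
  assumes T: "quadrilinear T"
    and f: "continuous_on S f1" "continuous_on S f2" "continuous_on S f3" "continuous_on S f4"
  shows "continuous_on S (\<lambda>x. T (f1 x) (f2 x) (f3 x) (f4 x))"
proof -
  have lin: "linear (\<lambda>u. T u v w z)" "linear (\<lambda>v. T u v w z)" "linear (\<lambda>w. T u v w z)" "linear (T u v w)"
    for u v w z
    using T by (auto simp: quadrilinear_def)
  have 4: "continuous_on S (\<lambda>x. T u v w (f4 x))" for u v w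
    by (subst linear_basis_expand[OF lin(4)]) (intro continuous_intros f)
  have 3: "continuous_on S (\<lambda>x. T u v (f3 x) (f4 x))" for u v
    by (subst linear_basis_expand[OF lin(3)]) (intro continuous_intros f 4)
  have 2: "continuous_on S (\<lambda>x. T u (f2 x) (f3 x) (f4 x))" for u
    by (subst linear_basis_expand[OF lin(2)]) (intro continuous_intros f 3)
  show ?thesis
    by (subst linear_basis_expand[OF lin(1)]) (intro continuous_intros f 2)
qed

text \<open>\<open>T u v w z\<close> stands for g(R_{u,v} w, z), so \<open>T a b b a\<close> is a
  sectional curvature on orthonormal pairs. With an abstract form in place of the curvature, the
  same lemmas apply to M and to the ambient manifold.\<close>

definition mutual :: "('a::euclidean_space \<Rightarrow> 'a \<Rightarrow> real) \<Rightarrow> ('a \<Rightarrow> 'a \<Rightarrow> 'a \<Rightarrow> 'a \<Rightarrow> real) \<Rightarrow>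
    'a set \<Rightarrow> 'a set \<Rightarrow> real" where
  "mutual ip T V W = (\<Sum>a\<in>some_onb ip V. \<Sum>b\<in>some_onb ip W. T a b b a)"

definition mutual_sum :: "('a::euclidean_space \<Rightarrow> 'a \<Rightarrow> real) \<Rightarrow> ('a \<Rightarrow> 'a \<Rightarrow> 'a \<Rightarrow> 'a \<Rightarrow> real) \<Rightarrow>
    nat \<Rightarrow> (nat \<Rightarrow> 'a set) \<Rightarrow> real" where
  "mutual_sum ip T k V = (\<Sum>j<k. \<Sum>i<j. mutual ip T (V i) (V j))"

text \<open>For \<open>\<beta>\<close> the second fundamental form this is H_V.\<close>

definition onb_trace :: "('a::euclidean_space \<Rightarrow> 'a \<Rightarrow> real) \<Rightarrow> ('a \<Rightarrow> 'a \<Rightarrow> 'b::real_vector) \<Rightarrow>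
    'a set \<Rightarrow> 'b" where
  "onb_trace ip \<beta> V = (\<Sum>a\<in>some_onb ip V. \<beta> a a)"

lemma orthogonal_subspacesD:
  assumes "orthogonal_subspaces ip E k n V"
  shows "i < k \<Longrightarrow> subspace (V i)" "i < k \<Longrightarrow> V i \<subseteq> E" "i < k \<Longrightarrow> dim (V i) = n i"
    "i < k \<Longrightarrow> j < k \<Longrightarrow> i \<noteq> j \<Longrightarrow> u \<in> V i \<Longrightarrow> v \<in> V j \<Longrightarrow> ip u v = 0"
  using assms by (auto simp: orthogonal_subspaces_def)

context inner_form
begin

lemma onb_trace:
  fixes \<beta> :: "'a \<Rightarrow> 'a \<Rightarrow> 'b::real_vector"
  assumes "orthonormal_basis ip V B" "bilinear \<beta>"
  shows "onb_trace ip \<beta> V = (\<Sum>b\<in>B. \<beta> b b)"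
proof -
  have "subspace V"
    using onb_span[OF assms(1)] subspace_span by blast
  then show ?thesis
    unfolding onb_trace_def using onb_trace_eq[OF some_onb assms] by blast
qed

text \<open>Trace invariance is used twice: for fixed \<open>a\<close> the inner sum is a trace in
  \<open>b\<close>, and the result is again bilinear in the two outer slots.\<close>

lemma mutual:
  assumes "orthonormal_basis ip V A" "orthonormal_basis ip W B" "quadrilinear T"
  shows "mutual ip T V W = (\<Sum>a\<in>A. \<Sum>b\<in>B. T a b b a)"
proof -
  have "subspace W"
    using onb_span[OF assms(2)] subspace_span by blast
  then have B: "(\<Sum>b\<in>some_onb ip W. T a b b a) = (\<Sum>b\<in>B. T a b b a)" for a
    using assms(3) by (intro onb_trace_eq[OF some_onb assms(2)]) (auto simp: bilinear_def quadrilinear_def)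
  have bil: "bilinear (\<lambda>a a'. \<Sum>b\<in>B. T a b b a')"
    using assms(3) unfolding bilinear_def quadrilinear_def by (auto intro!: linear_compose_sum)
  show ?thesis
    using onb_trace[OF assms(1) bil] by (simp add: mutual_def B onb_trace_def)
qed

text \<open>The pair (i, m) with m < \<open>n i\<close> indexes the m-th basis vector of the i-th
  subspace, so that one frame on \<open>index_blocks\<close> encodes a whole family of mutually
  orthogonal subspaces.\<close>

definition index_block :: "(nat \<Rightarrow> nat) \<Rightarrow> nat \<Rightarrow> (nat \<times> nat) set" where
  "index_block n i = {i} \<times> {..<n i}"

lemma index_block [simp]: "finite (index_block n i)" "card (index_block n i) = n i"
  by (simp_all add: index_block_def)

definition index_blocks :: "(nat \<Rightarrow> nat) \<Rightarrow> nat \<Rightarrow> (nat \<times> nat) set" where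
  "index_blocks n k = (\<Union>i<k. index_block n i)"

lemma index_blocks: "finite (index_blocks n k)" "card (index_blocks n k) = (\<Sum>i<k. n i)"
  unfolding index_blocks_def
  by simp (subst card_UN_disjoint, auto simp: index_block_def)

lemma index_block_subset: "i < k \<Longrightarrow> index_block n i \<subseteq> index_blocks n k"
  by (auto simp: index_blocks_def)

lemma frame_blocks_orthogonal:
  assumes e: "e \<in> frames E (index_blocks n k)" and E: "subspace E"
  shows "orthogonal_subspaces ip E k n (\<lambda>i. span (e ` index_block n i))"
  unfolding orthogonal_subspaces_def
proof (intro conjI allI impI ballI)
  fix i assume "i < k"
  then have sub: "index_block n i \<subseteq> index_blocks n k"
    by (rule index_block_subset)
  show "dim (span (e ` index_block n i)) = n i"
    using card_frame_dim[OF e sub] by simp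
  show "span (e ` index_block n i) \<subseteq> E"
    using frames_mem[OF e] sub E by (intro span_minimal) auto
next
  fix i j u v assume ij: "i < k" "j < k" "i \<noteq> j"
    and u: "u \<in> span (e ` index_block n i)" and v: "v \<in> span (e ` index_block n j)"
  have "ip (e p) (e q) = 0" if "p \<in> index_block n i" "q \<in> index_block n j" for p q
  proof -
    have "p \<in> index_blocks n k" "q \<in> index_blocks n k" "p \<noteq> q"
      using that ij by (auto simp: index_blocks_def index_block_def)
    then show ?thesis
      using frames_ip[OF e, of p q] by simp
  qed
  then have "ip u (e q) = 0" if "q \<in> index_block n j" for q
    using linear_eq_0_on_span[OF linear_left _ u, of "e q"] that by blast
  then show "ip u v = 0"
    using linear_eq_0_on_span[OF linear_right _ v, of u] by blast
qed auto

lemma mutual_sum_frame: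
  assumes T: "quadrilinear T"
    and onb: "\<And>i. i < k \<Longrightarrow> orthonormal_basis ip (V i) (e ` index_block n i)"
    and inj: "\<And>i. i < k \<Longrightarrow> inj_on e (index_block n i)"
  shows "mutual_sum ip T k V =
    (\<Sum>j<k. \<Sum>i<j. \<Sum>p\<in>index_block n i. \<Sum>q\<in>index_block n j. T (e p) (e q) (e q) (e p))"
  unfolding mutual_sum_def
proof (intro sum.cong refl)
  fix j i assume "j \<in> {..<k}" "i \<in> {..<j}"
  then have "i < k" "j < k" by auto
  then show "mutual ip T (V i) (V j) =
      (\<Sum>p\<in>index_block n i. \<Sum>q\<in>index_block n j. T (e p) (e q) (e q) (e p))"
    by (simp add: mutual[OF onb onb T] sum.reindex[OF inj])
qed

text \<open>Converse of \<open>frame_blocks_orthogonal\<close>: enumerated bases of the single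
  subspaces are glued into one frame, whose different blocks are orthogonal because the subspaces
  are.\<close>

lemma orthogonal_subspaces_frame:
  assumes V: "orthogonal_subspaces ip E k n V"
  obtains e where "e \<in> frames E (index_blocks n k)"
    "\<And>i. i < k \<Longrightarrow> bij_betw e (index_block n i) (some_onb ip (V i))"
proof -
  note D = orthogonal_subspacesD[OF V]
  have "\<exists>f. f \<in> frames (V i) (index_block n i) \<and> bij_betw f (index_block n i) (some_onb ip (V i))"
    if "i < k" for i
    using onb_frame[OF some_onb[OF D(1)[OF that]] order.refl, of "index_block n i"] D(3)[OF that]
    by auto
  then obtain f where f: "\<And>i. i < k \<Longrightarrow> f i \<in> frames (V i) (index_block n i)"
      "\<And>i. i < k \<Longrightarrow> bij_betw (f i) (index_block n i) (some_onb ip (V i))"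
    by metis
  define e where "e p = (if p \<in> index_blocks n k then f (fst p) p else 0)" for p
  have e_eq: "e p = f i p" if "i < k" "p \<in> index_block n i" for i p
    using that index_block_subset[OF that(1), of n] by (auto simp: e_def index_block_def)
  have "e \<in> frames E (index_blocks n k)"
    unfolding frames_def
  proof (intro CollectI conjI allI impI)
    fix p assume "p \<in> index_blocks n k"
    then obtain i where i: "i < k" "p \<in> index_block n i"
      by (auto simp: index_blocks_def)
    then have ei: "e p \<in> V i"
      using frames_mem[OF f(1)] by (simp add: e_eq)
    then show "e p \<in> E"
      using D(2) i by blast
    fix q assume "q \<in> index_blocks n k"
    then obtain j where j: "j < k" "q \<in> index_block n j"
      by (auto simp: index_blocks_def)
    then have ej: "e q \<in> V j"
      using frames_mem[OF f(1)] by (simp add: e_eq)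
    show "ip (e p) (e q) = (if p = q then 1 else 0)"
    proof (cases "i = j")
      case True
      then show ?thesis
        using i j frames_ip[OF f(1)] by (simp add: e_eq)
    next
      case False
      then have "p \<noteq> q"
        using i j by (auto simp: index_block_def)
      then show ?thesis
        using D(4)[OF i(1) j(1) False ei ej] by simp
    qed
  qed (simp add: e_def)
  moreover have "bij_betw e (index_block n i) (some_onb ip (V i))" if "i < k" for i
    using f(2)[OF that] e_eq[OF that] by (simp cong: bij_betw_cong)
  ultimately show ?thesis
    using that by blast
qed

text \<open>Compactness yields a maximal frame, whose block spans form \<open>V\<close>, and every
  competitor arises from some frame. Thus the \<open>GREATEST\<close> in the delta invariants is a
  genuine maximum.\<close>

lemma mutual_sum_attains_max:
  assumes E: "subspace E" and n: "(\<Sum>i<k. n i) \<le> dim E" and T: "quadrilinear T"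
  shows "\<exists>V. orthogonal_subspaces ip E k n V \<and>
    (\<forall>W. orthogonal_subspaces ip E k n W \<longrightarrow> mutual_sum ip T k W \<le> mutual_sum ip T k V)"
proof -
  define \<Phi> where "\<Phi> e = (\<Sum>j<k. \<Sum>i<j. \<Sum>p\<in>index_block n i. \<Sum>q\<in>index_block n j.
      T (e p) (e q) (e q) (e p))" for e
  have "continuous_on UNIV \<Phi>"
    unfolding \<Phi>_def
    by (intro continuous_intros continuous_on_quadrilinear[OF T] continuous_on_product_coordinates)
  then obtain e where e: "e \<in> frames E (index_blocks n k)"
      and max: "\<And>e'. e' \<in> frames E (index_blocks n k) \<Longrightarrow> \<Phi> e' \<le> \<Phi> e"
    using frames_attains_max[OF E index_blocks(1)[of n k], of \<Phi>] n unfolding index_blocks(2) by blast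
  define V where "V i = span (e ` index_block n i)" for i
  have V: "orthogonal_subspaces ip E k n V"
    unfolding V_def by (rule frame_blocks_orthogonal[OF e E])
  have "mutual_sum ip T k V = \<Phi> e"
    unfolding \<Phi>_def V_def
    by (intro mutual_sum_frame[OF T] frame_onb[OF e] index_block_subset index_block)
  moreover have "mutual_sum ip T k W \<le> \<Phi> e" if W: "orthogonal_subspaces ip E k n W" for W
  proof -
    obtain f where f: "f \<in> frames E (index_blocks n k)"
        and bij: "\<And>i. i < k \<Longrightarrow> bij_betw f (index_block n i) (some_onb ip (W i))"
      using orthogonal_subspaces_frame[OF W] by blast
    have "mutual_sum ip T k W = \<Phi> f"
      unfolding \<Phi>_def
      using bij some_onb[OF orthogonal_subspacesD(1)[OF W]]
      by (intro mutual_sum_frame[OF T]) (auto simp: bij_betw_def)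
    then show ?thesis
      using max[OF f] by simp
  qed
  ultimately show ?thesis
    using V by metis
qed

text \<open>With \<open>\<beta>\<close> the second fundamental form and \<open>N\<close> the metric
  norm, this says that the maximum in \<open>max_mean_curv\<close> is attained.\<close>

lemma onb_trace_attains_max:
  fixes \<beta> :: "'a \<Rightarrow> 'a \<Rightarrow> 'b::euclidean_space" and N :: "'b \<Rightarrow> real"
  assumes E: "subspace E" and s: "s \<le> dim E" and \<beta>: "bilinear \<beta>" and N: "continuous_on UNIV N"
  shows "\<exists>V. subspace V \<and> V \<subseteq> E \<and> dim V = s \<and>
    (\<forall>W. subspace W \<longrightarrow> W \<subseteq> E \<longrightarrow> dim W = s \<longrightarrow> N (onb_trace ip \<beta> W) \<le> N (onb_trace ip \<beta> V))"
proof -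
  define \<Phi> where "\<Phi> e = N (\<Sum>i<s. \<beta> (e i) (e i))" for e
  have \<beta>c: "continuous_on UNIV (\<lambda>e :: nat \<Rightarrow> 'a. \<beta> (e i) (e i))" for i
    by (rule bounded_bilinear.continuous_on[OF \<beta>[unfolded bilinear_conv_bounded_bilinear]])
      (rule continuous_on_product_coordinates)+
  have "continuous_on UNIV \<Phi>"
    unfolding \<Phi>_def by (intro continuous_on_compose2[OF N] continuous_intros \<beta>c) auto
  then obtain e where e: "e \<in> frames E {..<s}"
      and max: "\<And>e'. e' \<in> frames E {..<s} \<Longrightarrow> \<Phi> e' \<le> \<Phi> e"
    using frames_attains_max[OF E finite_lessThan, of s \<Phi>] s unfolding card_lessThan by blast
  define V where "V = span (e ` {..<s})"
  have "V \<subseteq> E"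
    unfolding V_def using frames_mem[OF e] E by (intro span_minimal) auto
  moreover have "subspace V" "dim V = s"
    using card_frame_dim[OF e order.refl] by (auto simp: V_def)
  moreover have "N (onb_trace ip \<beta> V) = \<Phi> e"
    unfolding \<Phi>_def V_def onb_trace[OF frame_onb(1)[OF e order.refl finite_lessThan] \<beta>]
    by (simp add: sum.reindex[OF frame_onb(2)[OF e order.refl]])
  moreover have "N (onb_trace ip \<beta> W) \<le> \<Phi> e" if W: "subspace W" "W \<subseteq> E" "dim W = s" for W
  proof -
    obtain f where f: "f \<in> frames E {..<s}" and bij: "bij_betw f {..<s} (some_onb ip W)"
      using onb_frame[OF some_onb[OF W(1)] W(2), of "{..<s}"] W(3) by auto
    have "N (onb_trace ip \<beta> W) = \<Phi> f"
      unfolding \<Phi>_def onb_trace_def using sum.reindex_bij_betw[OF bij, of "\<lambda>a. \<beta> a a"] by simp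
    then show ?thesis
      using max[OF f] by simp
  qed
  ultimately show ?thesis
    by metis
qed

lemma onb_Union:
  assumes V: "orthogonal_subspaces ip E k n V"
  shows "orthonormal_basis ip (span (\<Union>i<k. V i)) (\<Union>i<k. some_onb ip (V i))"
    and "i < k \<Longrightarrow> j < k \<Longrightarrow> i \<noteq> j \<Longrightarrow> some_onb ip (V i) \<inter> some_onb ip (V j) = {}"
proof -
  note D = orthogonal_subspacesD[OF V]
  have onb: "orthonormal_basis ip (V i) (some_onb ip (V i))" if "i < k" for i
    using some_onb[OF D(1)[OF that]] .
  have perp: "ip a b = 0" if "i < k" "j < k" "i \<noteq> j" "a \<in> some_onb ip (V i)" "b \<in> some_onb ip (V j)"
    for i j a b
    using D(4)[OF that(1-3) onb_mem[OF onb[OF that(1)] that(4)] onb_mem[OF onb[OF that(2)] that(5)]] .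
  have unit: "ip a a = 1" if "i < k" "a \<in> some_onb ip (V i)" for i a
    using onb[OF that(1)] that(2) by (simp add: orthonormal_basis_def)
  show disj: "some_onb ip (V i) \<inter> some_onb ip (V j) = {}" if "i < k" "j < k" "i \<noteq> j" for i j
    using perp[OF that] unit[OF that(1)] by force
  have "span (\<Union>i<k. some_onb ip (V i)) = span (\<Union>i<k. V i)"
  proof
    show "span (\<Union>i<k. some_onb ip (V i)) \<subseteq> span (\<Union>i<k. V i)"
      using onb_mem[OF onb] by (intro span_mono) blast
    have "V i \<subseteq> span (\<Union>i<k. some_onb ip (V i))" if "i < k" for i
      using onb_span[OF onb[OF that]] span_mono[of "some_onb ip (V i)" "\<Union>i<k. some_onb ip (V i)"] that
      by blast
    then show "span (\<Union>i<k. V i) \<subseteq> span (\<Union>i<k. some_onb ip (V i))"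
      by (intro span_minimal) auto
  qed
  moreover have "ip a b = (if a = b then 1 else 0)"
    if "i < k" "j < k" "a \<in> some_onb ip (V i)" "b \<in> some_onb ip (V j)" for i j a b
  proof (cases "i = j")
    case True
    then show ?thesis
      using onb[OF that(1)] that by (simp add: orthonormal_basis_def)
  next
    case False
    then show ?thesis
      using perp[OF that(1,2) False that(3,4)] disj[OF that(1,2) False] that by auto
  qed
  moreover have "finite (\<Union>i<k. some_onb ip (V i))"
    using onb_finite[OF onb] by auto
  ultimately show "orthonormal_basis ip (span (\<Union>i<k. V i)) (\<Union>i<k. some_onb ip (V i))"
    unfolding orthonormal_basis_def by blast
qed

text \<open>Gives H_V = H_1 + ... + H_k: the chosen bases are disjoint and their union is an
  orthonormal basis of the span.\<close>

lemma onb_trace_Union: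
  fixes \<beta> :: "'a \<Rightarrow> 'a \<Rightarrow> 'b::real_vector"
  assumes V: "orthogonal_subspaces ip E k n V" and \<beta>: "bilinear \<beta>"
  shows "onb_trace ip \<beta> (span (\<Union>i<k. V i)) = (\<Sum>i<k. onb_trace ip \<beta> (V i))"
proof -
  have "finite (some_onb ip (V i))" if "i < k" for i
    using onb_finite[OF some_onb[OF orthogonal_subspacesD(1)[OF V that]]] .
  then show ?thesis
    unfolding onb_trace[OF onb_Union(1)[OF V] \<beta>] unfolding onb_trace_def
    using onb_Union(2)[OF V] by (intro sum.UNION_disjoint) auto
qed

text \<open>Needed so that the span competes in the maximum over subspaces of dimension s.\<close>

lemma dim_Union:
  assumes V: "orthogonal_subspaces ip E k n V"
  shows "dim (span (\<Union>i<k. V i)) = (\<Sum>i<k. n i)"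
proof -
  note D = orthogonal_subspacesD[OF V]
  have onb: "orthonormal_basis ip (V i) (some_onb ip (V i))" if "i < k" for i
    using some_onb[OF D(1)[OF that]] .
  have "dim (span (\<Union>i<k. V i)) = card (\<Union>i<k. some_onb ip (V i))"
    using onb_dim[OF onb_Union(1)[OF V]] by simp
  also have "\<dots> = (\<Sum>i<k. card (some_onb ip (V i)))"
    using onb_finite[OF onb] onb_Union(2)[OF V] by (intro card_UN_disjoint) auto
  also have "\<dots> = (\<Sum>i<k. n i)"
    using onb_dim[OF onb] D(3) by (intro sum.cong) auto
  finally show ?thesis .
qed

text \<open>Origin of (k-1)/(2k). Write Q for the sum of |H_i|^2 and P for the sum of <H_i, H_j>
  over i < j. Then |H_1 + ... + H_k|^2 = Q + 2P, the squared differences add up to (k-1)Q - 2P, and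
  eliminating Q leaves 2kP.\<close>

lemma sum_pairs_eq:
  "2 * real k * (\<Sum>j<k. \<Sum>i<j. ip (H i) (H j)) =
    (real k - 1) * ip (\<Sum>i<k. H i) (\<Sum>i<k. H i) - (\<Sum>j<k. \<Sum>i<j. ip (H i - H j) (H i - H j))"
proof -
  have sq: "ip (\<Sum>i<k. H i) (\<Sum>i<k. H i) = (\<Sum>i<k. ip (H i) (H i)) + 2 * (\<Sum>j<k. \<Sum>i<j. ip (H i) (H j))"
    for k
  proof (induction k)
    case (Suc k)
    have "ip (\<Sum>i<k. H i) (H k) = (\<Sum>i<k. ip (H i) (H k))" "ip (H k) (\<Sum>i<k. H i) = (\<Sum>i<k. ip (H i) (H k))"
      using sum_left[of H "{..<k}" "H k"] sym[of "H k" "\<Sum>i<k. H i"] by simp_all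
    then show ?case
      using Suc by (simp add: simps algebra_simps)
  qed (simp add: simps)
  have diff: "(\<Sum>j<k. \<Sum>i<j. ip (H i - H j) (H i - H j)) =
      (real k - 1) * (\<Sum>i<k. ip (H i) (H i)) - 2 * (\<Sum>j<k. \<Sum>i<j. ip (H i) (H j))" for k
  proof (induction k)
    case (Suc k)
    have "(\<Sum>i<k. ip (H i - H k) (H i - H k)) =
        (\<Sum>i<k. ip (H i) (H i)) + real k * ip (H k) (H k) - 2 * (\<Sum>i<k. ip (H i) (H k))"
    proof -
      have "ip (H i - H k) (H i - H k) = ip (H i) (H i) + ip (H k) (H k) - 2 * ip (H i) (H k)" for i
        using sym[of "H k" "H i"] by (simp add: simps)
      then show ?thesis
        by (simp add: sum_subtractf sum.distrib sum_distrib_left)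
    qed
    with Suc show ?case
      by (simp add: algebra_simps)
  qed simp
  show ?thesis
    unfolding sq diff by (simp add: algebra_simps)
qed

end

section \<open>The inequality at a point\<close>

lemma Greatest_attained:
  fixes r :: real
  assumes "P r" "\<And>y. P y \<Longrightarrow> y \<le> r"
  shows "(GREATEST x. P x) = r"
  using assms by (rule Greatest_equality)

lemma isometry_onb:
  assumes "linear L" "inj L" "\<And>u v. ip u v = ip' (L u) (L v)" "orthonormal_basis ip V B"
  shows "orthonormal_basis ip' (L ` V) (L ` B)"
  using assms by (auto simp: orthonormal_basis_def linear_span_image inj_eq)

text \<open>What the algebra needs from the geometry at one point: \<open>L\<close> is the
  differential, \<open>h\<close> the second fundamental form, \<open>T\<close> and \<open>T'\<close>
  the intrinsic and ambient curvature forms. Multilinearity is asked of \<open>T'\<close> alone;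
  that of \<open>T\<close> follows from \<open>gauss\<close>.\<close>

locale gauss_data = dom: inner_form ip + amb: inner_form ip'
  for ip :: "'a::euclidean_space \<Rightarrow> 'a \<Rightarrow> real" and ip' :: "'b::euclidean_space \<Rightarrow> 'b \<Rightarrow> real" +
  fixes L :: "'a \<Rightarrow> 'b" and h :: "'a \<Rightarrow> 'a \<Rightarrow> 'b"
    and T :: "'a \<Rightarrow> 'a \<Rightarrow> 'a \<Rightarrow> 'a \<Rightarrow> real" and T' :: "'b \<Rightarrow> 'b \<Rightarrow> 'b \<Rightarrow> 'b \<Rightarrow> real"
  assumes linear_L: "linear L" and isometry: "ip u v = ip' (L u) (L v)"
    and bilinear_h: "bilinear h" and h_sym: "h u v = h v u"
    and T': "quadrilinear T'"
    and gauss: "T u v w z = T' (L u) (L v) (L w) (L z) + ip' (h v w) (h u z) - ip' (h u w) (h v z)"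
begin

lemma inj_L: "inj L"
proof -
  have "u = 0" if "L u = 0" for u
    using that isometry[of u u] dom.eq_0_iff[of u] by (simp add: amb.simps)
  then show ?thesis
    using linear_injective_0[OF linear_L] by blast
qed

lemma T: "quadrilinear T"
proof -
  have *: "linear (\<lambda>x. f (L x))" if "linear f" for f :: "'b \<Rightarrow> real"
    using linear_compose[OF linear_L that] by (simp add: o_def)
  have c: "linear (\<lambda>x. ip' (f x) c)" "linear (\<lambda>x. ip' c (f x))" if "linear f" for f :: "'a \<Rightarrow> 'b" and c
    using linear_compose[OF that amb.linear_left[of c]] linear_compose[OF that amb.linear_right[of c]]
    by (simp_all add: o_def)
  have h: "linear (\<lambda>x. h x w)" "linear (\<lambda>x. h w x)" for w
    using bilinear_h by (auto simp: bilinear_def)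
  show ?thesis
    unfolding quadrilinear_def gauss
    using T' by (auto simp: quadrilinear_def intro!: linear_compose_add linear_compose_sub * c h)
qed

text \<open>At u = z = a and v = w = b the Gauss equation contributes <h(b,b), h(a,a)>, which sums
  to the product of the traces, minus <h(a,b), h(b,a)>, a square by symmetry of
  \<open>h\<close>.\<close>

lemma mutual_gauss:
  assumes V: "subspace V" and W: "subspace W"
  shows "mutual ip T V W = mutual ip' T' (L ` V) (L ` W) + ip' (onb_trace ip h V) (onb_trace ip h W)
    - (\<Sum>a\<in>some_onb ip V. \<Sum>b\<in>some_onb ip W. ip' (h a b) (h a b))"
proof -
  note onb = dom.some_onb[OF V] dom.some_onb[OF W]
  have inj: "inj_on L B" for B
    using inj_L by (rule inj_on_subset) simp
  have "mutual ip' T' (L ` V) (L ` W) =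
      (\<Sum>a\<in>some_onb ip V. \<Sum>b\<in>some_onb ip W. T' (L a) (L b) (L b) (L a))"
    using amb.mutual[OF onb[THEN isometry_onb[of L ip ip', OF linear_L inj_L isometry]] T']
    by (simp add: sum.reindex[OF inj])
  moreover have "ip' (onb_trace ip h V) (onb_trace ip h W) =
      (\<Sum>a\<in>some_onb ip V. \<Sum>b\<in>some_onb ip W. ip' (h b b) (h a a))"
    unfolding onb_trace_def amb.sum_left amb.sum_right
    by (subst sum.swap) (intro sum.cong refl amb.sym)
  moreover have "ip' (h a b) (h b a) = ip' (h a b) (h a b)" for a b
    by (simp add: h_sym[of b a])
  ultimately show ?thesis
    unfolding mutual_def[of ip T] gauss by (simp add: sum.distrib sum_subtractf)
qed

section \<open>The two nonnegative defects in the summed Gauss equation\<close>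

definition cross_norm :: "nat \<Rightarrow> (nat \<Rightarrow> 'a set) \<Rightarrow> real" where
  "cross_norm k V = (\<Sum>j<k. \<Sum>i<j. \<Sum>a\<in>some_onb ip (V i). \<Sum>b\<in>some_onb ip (V j). ip' (h a b) (h a b))"

definition trace_defect :: "nat \<Rightarrow> (nat \<Rightarrow> 'a set) \<Rightarrow> real" where
  "trace_defect k V = (\<Sum>j<k. \<Sum>i<j. ip' (onb_trace ip h (V i) - onb_trace ip h (V j))
      (onb_trace ip h (V i) - onb_trace ip h (V j)))"

lemma cross_norm_nonneg: "0 \<le> cross_norm k V"
  unfolding cross_norm_def by (intro sum_nonneg amb.nonneg)

lemma trace_defect_nonneg: "0 \<le> trace_defect k V"
  unfolding trace_defect_def by (intro sum_nonneg amb.nonneg)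

lemma trace_defect_eq_0_iff:
  "trace_defect k V = 0 \<longleftrightarrow> (\<forall>i<k. \<forall>j<k. onb_trace ip h (V i) = onb_trace ip h (V j))"
proof -
  have "trace_defect k V = 0 \<longleftrightarrow> (\<forall>j<k. \<forall>i<j. onb_trace ip h (V i) = onb_trace ip h (V j))"
    unfolding trace_defect_def
    by (simp add: sum_nonneg_eq_0_iff sum_nonneg amb.nonneg amb.eq_0_iff Ball_def)
  also have "\<dots> \<longleftrightarrow> (\<forall>i<k. \<forall>j<k. onb_trace ip h (V i) = onb_trace ip h (V j))"
    by (metis linorder_neqE_nat order.strict_trans)
  finally show ?thesis .
qed

text \<open>Vanishing on basis vectors extends to the subspaces by bilinearity, one slot at a time.
  The sum runs over i < j only; symmetry of \<open>h\<close> supplies i > j.\<close>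

lemma cross_norm_eq_0_iff:
  assumes V: "orthogonal_subspaces ip E k n V"
  shows "cross_norm k V = 0 \<longleftrightarrow> (\<forall>i<k. \<forall>j<k. i \<noteq> j \<longrightarrow> (\<forall>u\<in>V i. \<forall>v\<in>V j. h u v = 0))"
proof -
  note onb = dom.some_onb[OF orthogonal_subspacesD(1)[OF V]]
  have "cross_norm k V = 0 \<longleftrightarrow>
      (\<forall>j<k. \<forall>i<j. \<forall>a\<in>some_onb ip (V i). \<forall>b\<in>some_onb ip (V j). h a b = 0)"
    unfolding cross_norm_def using dom.onb_finite[OF onb]
    by (simp add: sum_nonneg_eq_0_iff sum_nonneg amb.nonneg amb.eq_0_iff Ball_def)
  also have "\<dots> \<longleftrightarrow> (\<forall>j<k. \<forall>i<j. \<forall>u\<in>V i. \<forall>v\<in>V j. h u v = 0)"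
  proof (intro iffI allI impI ballI)
    fix i j u v
    assume 0: "\<forall>j<k. \<forall>i<j. \<forall>a\<in>some_onb ip (V i). \<forall>b\<in>some_onb ip (V j). h a b = 0"
      and ij: "j < k" "i < j" and uv: "u \<in> V i" "v \<in> V j"
    have i: "i < k" using ij by simp
    have lin: "linear (\<lambda>u. h u w)" "linear (h w)" for w
      using bilinear_h by (auto simp: bilinear_def)
    have "h a v = 0" if "a \<in> some_onb ip (V i)" for a
      using linear_eq_0_on_span[OF lin(2)] 0 ij that uv dom.onb_span[OF onb[OF ij(1)]] by metis
    then show "h u v = 0"
      using linear_eq_0_on_span[OF lin(1)] uv dom.onb_span[OF onb[OF i]] by metis
  next
    fix i j a b
    assume "\<forall>j<k. \<forall>i<j. \<forall>u\<in>V i. \<forall>v\<in>V j. h u v = 0" "j < k" "i < j"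
      "a \<in> some_onb ip (V i)" "b \<in> some_onb ip (V j)"
    then show "h a b = 0"
      using dom.onb_mem[OF onb] by (meson order.strict_trans)
  qed
  also have "\<dots> \<longleftrightarrow> (\<forall>i<k. \<forall>j<k. i \<noteq> j \<longrightarrow> (\<forall>u\<in>V i. \<forall>v\<in>V j. h u v = 0))"
  proof (intro iffI allI impI ballI)
    fix i j u v
    assume 0: "\<forall>j<k. \<forall>i<j. \<forall>u\<in>V i. \<forall>v\<in>V j. h u v = 0"
      and ij: "i < k" "j < k" "i \<noteq> j" "u \<in> V i" "v \<in> V j"
    show "h u v = 0"
    proof (cases "i < j")
      case False
      then have "j < i"
        using ij by simp
      then have "h v u = 0"
        using 0 ij by blast
      then show ?thesis
        by (simp add: h_sym[of u v])
    qed (use 0 ij in blast)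
  next
    fix i j u v
    assume 0: "\<forall>i<k. \<forall>j<k. i \<noteq> j \<longrightarrow> (\<forall>u\<in>V i. \<forall>v\<in>V j. h u v = 0)"
      and ij: "j < k" "i < j" "u \<in> V i" "v \<in> V j"
    have "i < k" "i \<noteq> j"
      using ij by simp_all
    then show "h u v = 0"
      using 0 ij by blast
  qed
  finally show ?thesis .
qed

lemma mutual_sum_gauss:
  assumes V: "orthogonal_subspaces ip E k n V" and k: "0 < k"
  shows "mutual_sum ip T k V = mutual_sum ip' T' k (\<lambda>i. L ` V i)
    + (real k - 1) / (2 * real k) * ip' (onb_trace ip h (span (\<Union>i<k. V i))) (onb_trace ip h (span (\<Union>i<k. V i)))
    - trace_defect k V / (2 * real k) - cross_norm k V"
proof -
  have sub: "subspace (V i)" if "i < k" for i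
    using orthogonal_subspacesD(1)[OF V that] .
  have "mutual_sum ip T k V = (\<Sum>j<k. \<Sum>i<j. mutual ip' T' (L ` V i) (L ` V j) +
      ip' (onb_trace ip h (V i)) (onb_trace ip h (V j)) -
      (\<Sum>a\<in>some_onb ip (V i). \<Sum>b\<in>some_onb ip (V j). ip' (h a b) (h a b)))"
    unfolding mutual_sum_def using sub by (intro sum.cong refl mutual_gauss) auto
  then have "mutual_sum ip T k V = mutual_sum ip' T' k (\<lambda>i. L ` V i) +
      (\<Sum>j<k. \<Sum>i<j. ip' (onb_trace ip h (V i)) (onb_trace ip h (V j))) - cross_norm k V"
    by (simp add: mutual_sum_def cross_norm_def sum.distrib sum_subtractf)
  moreover have "2 * real k * (\<Sum>j<k. \<Sum>i<j. ip' (onb_trace ip h (V i)) (onb_trace ip h (V j))) =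
      (real k - 1) * ip' (onb_trace ip h (span (\<Union>i<k. V i))) (onb_trace ip h (span (\<Union>i<k. V i)))
      - trace_defect k V"
    unfolding dom.onb_trace_Union[OF V bilinear_h] trace_defect_def
    by (rule amb.sum_pairs_eq)
  then have "(\<Sum>j<k. \<Sum>i<j. ip' (onb_trace ip h (V i)) (onb_trace ip h (V j))) =
      ((real k - 1) * ip' (onb_trace ip h (span (\<Union>i<k. V i))) (onb_trace ip h (span (\<Union>i<k. V i)))
      - trace_defect k V) / (2 * real k)"
    using k by (simp add: field_simps)
  ultimately show ?thesis
    by (simp only: diff_divide_distrib[of "_ * _" "trace_defect k V"] times_divide_eq_left)
qed

lemma image_orthogonal_subspaces:
  assumes V: "orthogonal_subspaces ip E k n V"
  shows "orthogonal_subspaces ip' UNIV k n (\<lambda>i. L ` V i)"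
proof -
  have "dim (L ` V i) = dim (V i)" for i
    by (rule dim_image_eq[OF linear_L inj_on_subset[OF inj_L subset_UNIV]])
  then show ?thesis
    using V linear_subspace_image[OF linear_L] isometry by (auto simp: orthogonal_subspaces_def)
qed

text \<open>For every admissible \<open>V\<close> the bound minus its curvature sum is a sum of four
  nonnegative terms: the shortfalls from the ambient maximum and from the maximal norm, and the two
  defects. At a maximising family this is the inequality; equality means that all four vanish for
  some family.\<close>

theorem mutual_curvature_inequality:
  fixes E :: "'a set" and n :: "nat \<Rightarrow> nat" and k s :: nat
  defines "\<delta> \<equiv> GREATEST r. \<exists>V. orthogonal_subspaces ip E k n V \<and> r = mutual_sum ip T k V"
    and "\<delta>' \<equiv> GREATEST r. \<exists>V. orthogonal_subspaces ip' UNIV k n V \<and> r = mutual_sum ip' T' k V"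
    and "\<H> \<equiv> GREATEST r. \<exists>V. subspace V \<and> V \<subseteq> E \<and> dim V = s \<and>
      r = sqrt (ip' (onb_trace ip h V) (onb_trace ip h V))"
  assumes E: "subspace E" and k: "k \<ge> 2" and n: "(\<Sum>i<k. n i) = s" and s: "s \<le> dim E"
  defines "bound \<equiv> \<delta>' + (real k - 1) / (2 * real k) *
      (if s < dim E then \<H>\<^sup>2 else (sqrt (ip' (onb_trace ip h E) (onb_trace ip h E)))\<^sup>2)"
  shows "\<delta> \<le> bound"
    and "\<delta> = bound \<longleftrightarrow> (\<exists>V. orthogonal_subspaces ip E k n V \<and>
      (\<forall>i<k. \<forall>j<k. i \<noteq> j \<longrightarrow> (\<forall>u\<in>V i. \<forall>v\<in>V j. h u v = 0)) \<and>
      (\<forall>i<k. \<forall>j<k. onb_trace ip h (V i) = onb_trace ip h (V j)) \<and>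
      sqrt (ip' (onb_trace ip h (span (\<Union>i<k. V i))) (onb_trace ip h (span (\<Union>i<k. V i)))) = \<H> \<and>
      mutual_sum ip' T' k (\<lambda>i. L ` V i) = \<delta>')"
proof -
  define c where "c = (real k - 1) / (2 * real k)"
  have c: "0 < c" using k by (simp add: c_def)
  \<comment> \<open>\<open>L\<close> is injective, so the ambient space has room for orthogonal
    subspaces of total dimension s, and the maximum \<open>\<delta>'\<close> is taken over a
    nonempty set.\<close>
  have dim_le: "dim E \<le> dim (UNIV :: 'b set)"
    using dim_image_eq[OF linear_L inj_on_subset[OF inj_L], of E] dim_subset_UNIV[of "L ` E"]
    by simp
  obtain V0 where V0: "orthogonal_subspaces ip E k n V0"
      "\<And>W. orthogonal_subspaces ip E k n W \<Longrightarrow> mutual_sum ip T k W \<le> mutual_sum ip T k V0"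
    using dom.mutual_sum_attains_max[OF E _ T, of n k] n s by blast
  then have \<delta>: "\<delta> = mutual_sum ip T k V0"
    unfolding \<delta>_def by (intro Greatest_attained) auto
  obtain W0 where W0: "orthogonal_subspaces ip' UNIV k n W0"
      "\<And>W. orthogonal_subspaces ip' UNIV k n W \<Longrightarrow> mutual_sum ip' T' k W \<le> mutual_sum ip' T' k W0"
    using amb.mutual_sum_attains_max[OF subspace_UNIV _ T', of n k] n s dim_le by fastforce
  then have \<delta>': "\<delta>' = mutual_sum ip' T' k W0"
    unfolding \<delta>'_def by (intro Greatest_attained) auto
  define nrm where "nrm V = sqrt (ip' (onb_trace ip h V) (onb_trace ip h V))" for V
  have nrm2: "(nrm V)\<^sup>2 = ip' (onb_trace ip h V) (onb_trace ip h V)" for V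
    by (simp add: nrm_def amb.nonneg)
  have nrm0: "0 \<le> nrm V" for V
    by (simp add: nrm_def amb.nonneg)
  have "continuous_on UNIV (\<lambda>w. sqrt (ip' w w))"
    by (intro continuous_intros amb.continuous_on_ip)
  from dom.onb_trace_attains_max[OF E s bilinear_h this]
  obtain X where X: "subspace X" "X \<subseteq> E" "dim X = s"
      "\<And>W. subspace W \<Longrightarrow> W \<subseteq> E \<Longrightarrow> dim W = s \<Longrightarrow> nrm W \<le> nrm X"
    unfolding nrm_def by blast
  then have \<H>: "\<H> = nrm X"
    unfolding \<H>_def nrm_def[symmetric] by (intro Greatest_attained) auto
  \<comment> \<open>For s = \<open>dim E\<close> the only competitor is \<open>E\<close> itself, so
    \<open>\<H>\<close> is the norm of H_E and both cases of \<open>bound\<close> take the same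
    form.\<close>
  have "X = E" if "\<not> s < dim E"
    using X s that E by (intro subspace_dim_equal) auto
  then have bound: "bound = \<delta>' + c * \<H>\<^sup>2"
    unfolding bound_def c_def \<H> nrm_def by auto
  define span_of where "span_of V = span (\<Union>i<k. V i)" for V :: "nat \<Rightarrow> 'a set"
  have gap: "bound - mutual_sum ip T k V = (\<delta>' - mutual_sum ip' T' k (\<lambda>i. L ` V i)) +
      c * (\<H>\<^sup>2 - (nrm (span_of V))\<^sup>2) + trace_defect k V / (2 * real k) + cross_norm k V"
    and ambient_le: "mutual_sum ip' T' k (\<lambda>i. L ` V i) \<le> \<delta>'"
    and nrm_le: "nrm (span_of V) \<le> \<H>"
    if V: "orthogonal_subspaces ip E k n V" for V
  proof -
    show "bound - mutual_sum ip T k V = (\<delta>' - mutual_sum ip' T' k (\<lambda>i. L ` V i)) +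
      c * (\<H>\<^sup>2 - (nrm (span_of V))\<^sup>2) + trace_defect k V / (2 * real k) + cross_norm k V"
      using mutual_sum_gauss[OF V] k unfolding bound nrm2 span_of_def c_def
      by (simp add: right_diff_distrib)
    show "mutual_sum ip' T' k (\<lambda>i. L ` V i) \<le> \<delta>'"
      unfolding \<delta>' using W0(2) image_orthogonal_subspaces[OF V] .
    have "(\<Union>i<k. V i) \<subseteq> E"
      using orthogonal_subspacesD(2)[OF V] by auto
    then have "span_of V \<subseteq> E"
      unfolding span_of_def using E by (rule span_minimal)
    then show "nrm (span_of V) \<le> \<H>"
      unfolding \<H> using dom.dim_Union[OF V] n by (intro X(4)) (auto simp: span_of_def)
  qed
  have sq_le: "(nrm (span_of V))\<^sup>2 \<le> \<H>\<^sup>2" if "orthogonal_subspaces ip E k n V" for V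
    using nrm_le[OF that] nrm0 by (intro power_mono)
  have gap_nonneg: "0 \<le> c * (\<H>\<^sup>2 - (nrm (span_of V))\<^sup>2)" "0 \<le> trace_defect k V / (2 * real k)"
    if "orthogonal_subspaces ip E k n V" for V
    using sq_le[OF that] c trace_defect_nonneg[of k V] by auto
  show le: "\<delta> \<le> bound"
    using gap[OF V0(1)] ambient_le[OF V0(1)] gap_nonneg[OF V0(1)] cross_norm_nonneg[of k V0]
    unfolding \<delta> by linarith
  have eq_iff: "mutual_sum ip T k V = bound \<longleftrightarrow>
      (\<forall>i<k. \<forall>j<k. i \<noteq> j \<longrightarrow> (\<forall>u\<in>V i. \<forall>v\<in>V j. h u v = 0)) \<and>
      (\<forall>i<k. \<forall>j<k. onb_trace ip h (V i) = onb_trace ip h (V j)) \<and>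
      nrm (span_of V) = \<H> \<and> mutual_sum ip' T' k (\<lambda>i. L ` V i) = \<delta>'"
    if V: "orthogonal_subspaces ip E k n V" for V
  proof -
    have "mutual_sum ip T k V = bound \<longleftrightarrow> cross_norm k V = 0 \<and> trace_defect k V / (2 * real k) = 0 \<and>
        c * (\<H>\<^sup>2 - (nrm (span_of V))\<^sup>2) = 0 \<and> mutual_sum ip' T' k (\<lambda>i. L ` V i) = \<delta>'"
      using gap[OF V] ambient_le[OF V] gap_nonneg[OF V] cross_norm_nonneg[of k V] by linarith
    \<comment> \<open>Equal squares give equal norms because both are nonnegative; \<open>c\<close>
      is positive because k is at least 2.\<close>
    moreover have "c * (\<H>\<^sup>2 - (nrm (span_of V))\<^sup>2) = 0 \<longleftrightarrow> nrm (span_of V) = \<H>"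
      using c nrm0[of "span_of V"] nrm0[of X] unfolding \<H> by auto
    ultimately show ?thesis
      using k cross_norm_eq_0_iff[OF V] trace_defect_eq_0_iff[of k V] by simp
  qed
  show "\<delta> = bound \<longleftrightarrow> (\<exists>V. orthogonal_subspaces ip E k n V \<and>
      (\<forall>i<k. \<forall>j<k. i \<noteq> j \<longrightarrow> (\<forall>u\<in>V i. \<forall>v\<in>V j. h u v = 0)) \<and>
      (\<forall>i<k. \<forall>j<k. onb_trace ip h (V i) = onb_trace ip h (V j)) \<and>
      sqrt (ip' (onb_trace ip h (span (\<Union>i<k. V i))) (onb_trace ip h (span (\<Union>i<k. V i)))) = \<H> \<and>
      mutual_sum ip' T' k (\<lambda>i. L ` V i) = \<delta>')"
    (is "_ \<longleftrightarrow> ?R")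
  proof -
    have "?R \<longleftrightarrow> (\<exists>V. orthogonal_subspaces ip E k n V \<and> mutual_sum ip T k V = bound)"
      using eq_iff unfolding nrm_def span_of_def by blast
    \<comment> \<open>Every curvature sum is at most \<open>\<delta>\<close>, and
      \<open>\<delta>\<close> is at most \<open>bound\<close>. So a family reaching
      \<open>bound\<close> forces equality; conversely, under equality \<open>V0\<close> reaches
      it.\<close>
    also have "\<dots> \<longleftrightarrow> \<delta> = bound"
      using V0 le unfolding \<delta> by force
    finally show ?thesis by blast
  qed
qed

end

section \<open>Calculus\<close>

lemma DERIV_along_line:
  fixes \<phi> :: "'a::real_normed_vector \<Rightarrow> real"
  assumes "(\<phi> has_derivative \<phi>') (at (c + s *\<^sub>R u))"
  shows "((\<lambda>s. \<phi> (c + s *\<^sub>R u)) has_field_derivative \<phi>' u) (at s)"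
proof -
  have "((\<lambda>s. c + s *\<^sub>R u) has_derivative (\<lambda>h. h *\<^sub>R u)) (at s)"
    by (auto intro!: derivative_eq_intros)
  from has_derivative_compose[OF this assms]
  have "((\<lambda>s. \<phi> (c + s *\<^sub>R u)) has_derivative (\<lambda>h. \<phi>' (h *\<^sub>R u))) (at s)" .
  moreover have "(\<lambda>h. \<phi>' (h *\<^sub>R u)) = (*) (\<phi>' u)"
    using has_derivative_linear[OF assms] by (auto simp: linear_scale)
  ultimately show ?thesis
    by (simp add: has_field_derivative_def)
qed

text \<open>The mean value theorem is applied twice: along \<open>u\<close> to the difference of
  \<open>\<phi>\<close> between opposite sides of the parallelogram, then along \<open>v\<close> to
  the resulting derivative. Only the parallelogram has to lie in \<open>S\<close>.\<close>

lemma second_difference: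
  fixes \<phi> :: "'a::real_normed_vector \<Rightarrow> real"
  assumes t: "0 < t"
    and S: "\<And>s r. 0 \<le> s \<Longrightarrow> s \<le> t \<Longrightarrow> 0 \<le> r \<Longrightarrow> r \<le> t \<Longrightarrow> p + s *\<^sub>R u + r *\<^sub>R v \<in> S"
    and d1: "\<And>q. q \<in> S \<Longrightarrow> (\<phi> has_derivative \<phi>' q) (at q)"
    and d2: "\<And>q. q \<in> S \<Longrightarrow> ((\<lambda>q. \<phi>' q u) has_derivative \<phi>u q) (at q)"
  shows "\<exists>s\<in>{0..t}. \<exists>r\<in>{0..t}. \<phi> (p + t *\<^sub>R u + t *\<^sub>R v) - \<phi> (p + t *\<^sub>R u) - \<phi> (p + t *\<^sub>R v) + \<phi> p
      = t * t * \<phi>u (p + s *\<^sub>R u + r *\<^sub>R v) v"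
proof -
  have "((\<lambda>s. \<phi> ((p + t *\<^sub>R v) + s *\<^sub>R u) - \<phi> (p + s *\<^sub>R u)) has_field_derivative
      \<phi>' (p + s *\<^sub>R u + t *\<^sub>R v) u - \<phi>' (p + s *\<^sub>R u) u) (at s)" if "0 \<le> s" "s \<le> t" for s
  proof (rule DERIV_diff)
    show "((\<lambda>s. \<phi> ((p + t *\<^sub>R v) + s *\<^sub>R u)) has_field_derivative \<phi>' (p + s *\<^sub>R u + t *\<^sub>R v) u) (at s)"
      using S[OF that, of t] t d1 by (intro DERIV_along_line) (simp add: algebra_simps)
    show "((\<lambda>s. \<phi> (p + s *\<^sub>R u)) has_field_derivative \<phi>' (p + s *\<^sub>R u) u) (at s)"
      using S[OF that, of 0] t d1 by (intro DERIV_along_line) simp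
  qed
  from MVT2[OF t this] obtain s where s: "0 < s" "s < t"
    and eq1: "\<phi> (p + t *\<^sub>R v + t *\<^sub>R u) - \<phi> (p + t *\<^sub>R u) - (\<phi> (p + t *\<^sub>R v + 0 *\<^sub>R u) - \<phi> (p + 0 *\<^sub>R u)) =
      (t - 0) * (\<phi>' (p + s *\<^sub>R u + t *\<^sub>R v) u - \<phi>' (p + s *\<^sub>R u) u)"
    by auto
  have "((\<lambda>r. \<phi>' (p + s *\<^sub>R u + r *\<^sub>R v) u) has_field_derivative \<phi>u (p + s *\<^sub>R u + r *\<^sub>R v) v) (at r)"
    if "0 \<le> r" "r \<le> t" for r
    using S[of s r] s that by (intro DERIV_along_line d2) simp
  from MVT2[OF t this] obtain r where r: "0 < r" "r < t"
    and eq2: "\<phi>' (p + s *\<^sub>R u + t *\<^sub>R v) u - \<phi>' (p + s *\<^sub>R u + 0 *\<^sub>R v) u =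
      (t - 0) * \<phi>u (p + s *\<^sub>R u + r *\<^sub>R v) v"
    by auto
  have "\<phi> (p + t *\<^sub>R u + t *\<^sub>R v) - \<phi> (p + t *\<^sub>R u) - \<phi> (p + t *\<^sub>R v) + \<phi> p
      = t * t * \<phi>u (p + s *\<^sub>R u + r *\<^sub>R v) v"
    using eq1 eq2 by (simp add: add.commute add.left_commute)
  then show ?thesis
    using s r by (intro bexI[of _ s] bexI[of _ r]) auto
qed

text \<open>The second difference is symmetric in \<open>u\<close> and \<open>v\<close>, so on each
  small parallelogram some value of one mixed derivative equals some value of the other; by
  continuity the values at \<open>p\<close> agree.\<close>

lemma mixed_derivatives_eq:
  fixes \<phi> :: "'a::real_normed_vector \<Rightarrow> real"
  assumes S: "open S" "p \<in> S"
    and d1: "\<And>q. q \<in> S \<Longrightarrow> (\<phi> has_derivative \<phi>' q) (at q)"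
    and du: "\<And>q. q \<in> S \<Longrightarrow> ((\<lambda>q. \<phi>' q u) has_derivative \<phi>u q) (at q)"
    and dv: "\<And>q. q \<in> S \<Longrightarrow> ((\<lambda>q. \<phi>' q v) has_derivative \<phi>v q) (at q)"
    and cu: "continuous_on S (\<lambda>q. \<phi>u q v)" and cv: "continuous_on S (\<lambda>q. \<phi>v q u)"
  shows "\<phi>u p v = \<phi>v p u"
proof -
  have "\<bar>\<phi>u p v - \<phi>v p u\<bar> \<le> e" if "0 < e" for e
  proof -
    have cont: "isCont (\<lambda>q. \<phi>u q v) p" "isCont (\<lambda>q. \<phi>v q u) p"
      using cu cv S by (simp_all add: continuous_on_eq_continuous_at)
    have "0 < e / 2"
      using \<open>0 < e\<close> by simp
    note nbhd = cont[unfolded continuous_at_eps_delta dist_real_def, rule_format, OF this]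
    obtain d1' where d1': "0 < d1'" "\<And>q. dist q p < d1' \<Longrightarrow> \<bar>\<phi>u q v - \<phi>u p v\<bar> < e / 2"
      using nbhd(1) by blast
    obtain d2' where d2': "0 < d2'" "\<And>q. dist q p < d2' \<Longrightarrow> \<bar>\<phi>v q u - \<phi>v p u\<bar> < e / 2"
      using nbhd(2) by blast
    obtain d3 where d3: "0 < d3" "ball p d3 \<subseteq> S"
      using S open_contains_ball by blast
    define d where "d = min d1' (min d2' d3)"
    have d: "0 < d"
      using d1' d2' d3 by (simp add: d_def)
    define m where "m = norm u + norm v + 1"
    \<comment> \<open>This size keeps the parallelogram within \<open>t * m\<close> =
      \<open>d / 2\<close> of \<open>p\<close>; the summand 1 makes \<open>m\<close> positive even
      if \<open>u\<close> and \<open>v\<close> are zero.\<close>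
    define t where "t = d / (2 * m)"
    have nz: "0 < m"
      by (simp add: m_def add_nonneg_pos)
    then have t: "0 < t"
      using d by (simp add: t_def)
    have near: "dist (p + s *\<^sub>R u + r *\<^sub>R v) p < d" if "0 \<le> s" "s \<le> t" "0 \<le> r" "r \<le> t" for s r
    proof -
      have "dist (p + s *\<^sub>R u + r *\<^sub>R v) p \<le> norm (s *\<^sub>R u) + norm (r *\<^sub>R v)"
        using norm_triangle_ineq[of "s *\<^sub>R u" "r *\<^sub>R v"] by (simp add: dist_norm add.assoc)
      also have "\<dots> \<le> t * norm u + t * norm v"
        using that by (intro add_mono) (auto intro: mult_right_mono)
      also have "\<dots> \<le> t * m"
        using t by (simp add: m_def algebra_simps)
      also have "\<dots> = d / 2"
        using nz by (simp add: t_def)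
      also have "\<dots> < d"
        using d by simp
      finally show ?thesis .
    qed
    have inS: "p + s *\<^sub>R u + r *\<^sub>R v \<in> S" if "0 \<le> s" "s \<le> t" "0 \<le> r" "r \<le> t" for s r
      using near[OF that] d3 by (auto simp: d_def mem_ball dist_commute)
    define \<Delta> where "\<Delta> = \<phi> (p + t *\<^sub>R u + t *\<^sub>R v) - \<phi> (p + t *\<^sub>R u) - \<phi> (p + t *\<^sub>R v) + \<phi> p"
    obtain s r where sr: "s \<in> {0..t}" "r \<in> {0..t}" "\<Delta> = t * t * \<phi>u (p + s *\<^sub>R u + r *\<^sub>R v) v"
      using second_difference[of t p u v S \<phi> \<phi>' \<phi>u, OF t inS d1 du] unfolding \<Delta>_def by blast
    have "p + s *\<^sub>R v + r *\<^sub>R u \<in> S" if "0 \<le> s" "s \<le> t" "0 \<le> r" "r \<le> t" for s r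
      using inS[of r s] that by (simp add: add_ac)
    from second_difference[of t p v u S \<phi> \<phi>' \<phi>v, OF t this d1 dv]
    obtain s' r' where sr': "s' \<in> {0..t}" "r' \<in> {0..t}" "\<Delta> = t * t * \<phi>v (p + s' *\<^sub>R v + r' *\<^sub>R u) u"
      unfolding \<Delta>_def by (auto simp: algebra_simps)
    have "\<phi>u (p + s *\<^sub>R u + r *\<^sub>R v) v = \<phi>v (p + r' *\<^sub>R u + s' *\<^sub>R v) u"
      using sr(3) sr'(3) t by (simp add: add_ac)
    moreover have "\<bar>\<phi>u (p + s *\<^sub>R u + r *\<^sub>R v) v - \<phi>u p v\<bar> < e / 2"
      using d1'(2) near[of s r] sr by (simp add: d_def)
    moreover have "\<bar>\<phi>v (p + r' *\<^sub>R u + s' *\<^sub>R v) u - \<phi>v p u\<bar> < e / 2"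
      using d2'(2) near[of r' s'] sr' by (simp add: d_def)
    ultimately show ?thesis
      by linarith
  qed
  then have "\<bar>\<phi>u p v - \<phi>v p u\<bar> \<le> 0"
    by (rule field_le_epsilon) simp
  then show ?thesis by simp
qed

lemma smooth_onD:
  assumes "smooth_on S f"
  shows smooth_on_differentiable: "x \<in> S \<Longrightarrow> f differentiable (at x)"
    and smooth_on_continuous: "continuous_on S f"
    and smooth_on_dir_deriv: "smooth_on S (\<lambda>x. dir_deriv f x v)"
proof -
  have "Ck_on (Suc k) S f" for k
    using assms by (simp add: smooth_on_def del: Ck_on.simps)
  then show "x \<in> S \<Longrightarrow> f differentiable (at x)" "smooth_on S (\<lambda>x. dir_deriv f x v)"
    by (auto simp: smooth_on_def)
  show "continuous_on S f"
    using assms by (metis smooth_on_def Ck_on.simps(1))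
qed

lemma smooth_on_has_derivative:
  assumes "smooth_on S f" "x \<in> S"
  shows "(f has_derivative dir_deriv f x) (at x)"
  using smooth_on_differentiable[OF assms] by (simp add: frechet_derivative_works)

lemma dir_deriv_commute:
  fixes f :: "'a::euclidean_space \<Rightarrow> 'b::euclidean_space"
  assumes f: "smooth_on S f" and S: "open S" "p \<in> S"
  shows "dir_deriv (\<lambda>q. dir_deriv f q u) p v = dir_deriv (\<lambda>q. dir_deriv f q v) p u"
proof (rule euclidean_eqI)
  fix b :: 'b
  note f1 = smooth_on_dir_deriv[OF f]
  show "dir_deriv (\<lambda>q. dir_deriv f q u) p v \<bullet> b = dir_deriv (\<lambda>q. dir_deriv f q v) p u \<bullet> b"
  proof (rule mixed_derivatives_eq[OF S, of "\<lambda>q. f q \<bullet> b" "\<lambda>q h. dir_deriv f q h \<bullet> b" u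
        "\<lambda>q h. dir_deriv (\<lambda>q. dir_deriv f q u) q h \<bullet> b" v
        "\<lambda>q h. dir_deriv (\<lambda>q. dir_deriv f q v) q h \<bullet> b"])
    show "continuous_on S (\<lambda>q. dir_deriv (\<lambda>q. dir_deriv f q u) q v \<bullet> b)" for u v
      by (intro continuous_intros smooth_on_continuous[OF smooth_on_dir_deriv[OF f1]])
    then show "continuous_on S (\<lambda>q. dir_deriv (\<lambda>q. dir_deriv f q v) q u \<bullet> b)" .
  qed (intro has_derivative_inner_left smooth_on_has_derivative[OF f] smooth_on_has_derivative[OF f1]; assumption)+
qed

section \<open>Differentiating fields of bilinear maps\<close>

lemma bilinear_basis_expand:
  fixes \<beta> :: "'a::euclidean_space \<Rightarrow> 'b::euclidean_space \<Rightarrow> 'c::real_vector"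
  assumes "bilinear \<beta>"
  shows "\<beta> a b = (\<Sum>i\<in>Basis. \<Sum>j\<in>Basis. ((a \<bullet> i) * (b \<bullet> j)) *\<^sub>R \<beta> i j)"
proof -
  have lin: "linear (\<lambda>u. \<beta> u w)" "linear (\<beta> v)" for v w
    using assms by (auto simp: bilinear_def)
  have "\<beta> a b = (\<Sum>i\<in>Basis. (a \<bullet> i) *\<^sub>R \<beta> i b)"
    using linear_basis_expand[OF lin(1)] .
  also have "\<dots> = (\<Sum>i\<in>Basis. (a \<bullet> i) *\<^sub>R (\<Sum>j\<in>Basis. (b \<bullet> j) *\<^sub>R \<beta> i j))"
    by (intro sum.cong refl arg_cong2[of _ _ _ _ scaleR] linear_basis_expand[OF lin(2)])
  finally show ?thesis
    by (simp add: scaleR_sum_right)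
qed

text \<open>The identities expressing bilinearity hold throughout an open set and may therefore be
  differentiated in the base point.\<close>

lemma bilinear_dir_deriv:
  fixes B :: "'e::real_normed_vector \<Rightarrow> 'a::real_vector \<Rightarrow> 'b::real_vector \<Rightarrow> 'c::real_normed_vector"
  assumes S: "open S" "y \<in> S" and bil: "\<And>y. y \<in> S \<Longrightarrow> bilinear (B y)"
    and diff: "\<And>a b. (\<lambda>y. B y a b) differentiable (at y)"
  shows "bilinear (\<lambda>a b. dir_deriv (\<lambda>y. B y a b) y z)"
proof -
  note d = diff[unfolded frechet_derivative_works]
  have eqI: "dir_deriv (\<lambda>y. B y a b) y z = F z"
    if "(g has_derivative F) (at y)" "\<And>y. y \<in> S \<Longrightarrow> g y = B y a b" for a b g F
    using has_derivative_transform_within_open[OF that(1) S that(2)] frechet_derivative_at by metis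
  have 1: "linear (\<lambda>a. dir_deriv (\<lambda>y. B y a b) y z)" for b
    by (rule linearI; rule eqI, (rule has_derivative_add has_derivative_scaleR_right, (rule d)+),
        simp add: bilinear_ladd[OF bil] bilinear_lmul[OF bil])
  have 2: "linear (\<lambda>b. dir_deriv (\<lambda>y. B y a b) y z)" for a
    by (rule linearI; rule eqI, (rule has_derivative_add has_derivative_scaleR_right, (rule d)+),
        simp add: bilinear_radd[OF bil] bilinear_rmul[OF bil])
  show ?thesis
    using 1 2 by (simp add: bilinear_def)
qed

text \<open>Product rule for three simultaneous dependences. Differentiability of \<open>B\<close>
  is known for fixed arguments only; expanding both arguments in bases reduces the claim to finite
  sums of products of differentiable functions.\<close>

lemma has_derivative_bilinear_along:
  fixes B :: "'e::real_normed_vector \<Rightarrow> 'a::euclidean_space \<Rightarrow> 'b::euclidean_space \<Rightarrow> 'c::real_normed_vector"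
    and f :: "'f::real_normed_vector \<Rightarrow> 'e"
  assumes S: "open S" "f q \<in> S" and bil: "\<And>y. y \<in> S \<Longrightarrow> bilinear (B y)"
    and diff: "\<And>a b. (\<lambda>y. B y a b) differentiable (at (f q))"
    and f: "(f has_derivative f') (at q)"
    and W1: "(W1 has_derivative W1') (at q)" and W2: "(W2 has_derivative W2') (at q)"
  shows "((\<lambda>q. B (f q) (W1 q) (W2 q)) has_derivative
    (\<lambda>u. dir_deriv (\<lambda>y. B y (W1 q) (W2 q)) (f q) (f' u) + B (f q) (W1' u) (W2 q) + B (f q) (W1 q) (W2' u)))
    (at q)"
proof -
  note d = diff[unfolded frechet_derivative_works]
  have Bf: "((\<lambda>q. B (f q) i j) has_derivative (\<lambda>u. dir_deriv (\<lambda>y. B y i j) (f q) (f' u))) (at q)" for i j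
    using has_derivative_compose[OF f d] .
  have "((\<lambda>q. \<Sum>i\<in>Basis. \<Sum>j\<in>Basis. ((W1 q \<bullet> i) * (W2 q \<bullet> j)) *\<^sub>R B (f q) i j) has_derivative
    (\<lambda>u. \<Sum>i\<in>Basis. \<Sum>j\<in>Basis. ((W1 q \<bullet> i) * (W2 q \<bullet> j)) *\<^sub>R dir_deriv (\<lambda>y. B y i j) (f q) (f' u) +
      ((W1 q \<bullet> i) * (W2' u \<bullet> j) + (W1' u \<bullet> i) * (W2 q \<bullet> j)) *\<^sub>R B (f q) i j)) (at q)"
    by (intro has_derivative_sum has_derivative_scaleR has_derivative_mult has_derivative_inner_left W1 W2 Bf)
  moreover have "(\<Sum>i\<in>Basis. \<Sum>j\<in>Basis. ((W1 q \<bullet> i) * (W2 q \<bullet> j)) *\<^sub>R dir_deriv (\<lambda>y. B y i j) (f q) (f' u) +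
      ((W1 q \<bullet> i) * (W2' u \<bullet> j) + (W1' u \<bullet> i) * (W2 q \<bullet> j)) *\<^sub>R B (f q) i j) =
      dir_deriv (\<lambda>y. B y (W1 q) (W2 q)) (f q) (f' u) + B (f q) (W1' u) (W2 q) + B (f q) (W1 q) (W2' u)" for u
    using bilinear_basis_expand[OF bilinear_dir_deriv[where B = B, OF S bil diff], of "W1 q" "W2 q" "f' u"]
      bilinear_basis_expand[OF bil[OF S(2)], of "W1' u" "W2 q"]
      bilinear_basis_expand[OF bil[OF S(2)], of "W1 q" "W2' u"]
    by (simp add: sum.distrib scaleR_add_left)
  ultimately have der: "((\<lambda>q. \<Sum>i\<in>Basis. \<Sum>j\<in>Basis. ((W1 q \<bullet> i) * (W2 q \<bullet> j)) *\<^sub>R B (f q) i j) has_derivative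
    (\<lambda>u. dir_deriv (\<lambda>y. B y (W1 q) (W2 q)) (f q) (f' u) + B (f q) (W1' u) (W2 q) + B (f q) (W1 q) (W2' u)))
    (at q)"
    by simp
  \<comment> \<open>The expansion uses bilinearity of \<open>B (f q')\<close>, hence is available
    only where \<open>f\<close> stays in \<open>S\<close>.\<close>
  have "isCont f q"
    using f by (rule has_derivative_continuous)
  then have "\<forall>\<^sub>F q' in at q. f q' \<in> S"
    using S topological_tendstoD[of f "f q" "at q" S] by (simp add: isCont_def)
  then have ev: "\<forall>\<^sub>F q' in at q. (\<Sum>i\<in>Basis. \<Sum>j\<in>Basis. ((W1 q' \<bullet> i) * (W2 q' \<bullet> j)) *\<^sub>R B (f q') i j) =
      B (f q') (W1 q') (W2 q')"
    by eventually_elim (rule bilinear_basis_expand[OF bil, symmetric])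
  show ?thesis
    by (rule has_derivative_transform_eventually[OF der ev])
      (use bilinear_basis_expand[OF bil[OF S(2)], of "W1 q" "W2 q"] in auto)
qed

text \<open>Here \<open>x\<close> is merely continuous. After splitting off \<open>x p\<close> times
  \<open>\<epsilon>\<close>, the remaining product is o(|q - p|), because \<open>x\<close> tends to
  \<open>x p\<close> and \<open>\<epsilon>\<close> is O(|q - p|).\<close>

lemma has_derivative_mult_vanishing:
  fixes x \<epsilon> :: "'a::real_normed_vector \<Rightarrow> real"
  assumes x: "isCont x p" and \<epsilon>: "(\<epsilon> has_derivative \<epsilon>') (at p)" "\<epsilon> p = 0"
  shows "((\<lambda>q. x q * \<epsilon> q) has_derivative (\<lambda>h. x p * \<epsilon>' h)) (at p)"
proof -
  have bl: "bounded_linear \<epsilon>'"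
    using \<epsilon>(1) by (rule has_derivative_bounded_linear)
  define r where "r q = norm (\<epsilon> q - \<epsilon> p - \<epsilon>' (q - p)) / norm (q - p)" for q
  have r: "(r \<longlongrightarrow> 0) (at p)"
    using \<epsilon>(1) unfolding r_def has_derivative_iff_norm by blast
  have "((\<lambda>q. \<bar>x q - x p\<bar> * (r q + onorm \<epsilon>')) \<longlongrightarrow> \<bar>x p - x p\<bar> * (0 + onorm \<epsilon>')) (at p)"
    using x unfolding isCont_def by (intro tendsto_intros r)
  then have lim: "((\<lambda>q. \<bar>x q - x p\<bar> * (r q + onorm \<epsilon>')) \<longlongrightarrow> 0) (at p)"
    by simp
  have "\<bar>(x q - x p) * \<epsilon> q\<bar> / norm (q - p) \<le> \<bar>x q - x p\<bar> * (r q + onorm \<epsilon>')" if "q \<noteq> p" for q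
  proof -
    have "\<bar>\<epsilon> q\<bar> \<le> \<bar>\<epsilon> q - \<epsilon>' (q - p)\<bar> + \<bar>\<epsilon>' (q - p)\<bar>"
      by linarith
    also have "\<bar>\<epsilon>' (q - p)\<bar> \<le> onorm \<epsilon>' * norm (q - p)"
      using onorm[OF bl, of "q - p"] by simp
    finally have "\<bar>\<epsilon> q\<bar> / norm (q - p) \<le> r q + onorm \<epsilon>'"
      using that \<epsilon>(2) by (simp add: r_def field_simps)
    from mult_left_mono[OF this, of "\<bar>x q - x p\<bar>"] show ?thesis
      by (simp add: abs_mult)
  qed
  then have "\<forall>\<^sub>F q in at p. norm (\<bar>(x q - x p) * \<epsilon> q\<bar> / norm (q - p)) \<le> \<bar>x q - x p\<bar> * (r q + onorm \<epsilon>')"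
    by (auto simp: eventually_at_filter)
  then have "((\<lambda>q. \<bar>(x q - x p) * \<epsilon> q\<bar> / norm (q - p)) \<longlongrightarrow> 0) (at p)"
    using lim by (rule Lim_null_comparison)
  then have "((\<lambda>q. (x q - x p) * \<epsilon> q) has_derivative (\<lambda>h. 0)) (at p)"
    by (simp add: has_derivative_iff_norm \<epsilon>(2))
  from has_derivative_add[OF has_derivative_mult_right[OF \<epsilon>(1), of "x p"] this]
  show ?thesis
    by (simp add: algebra_simps)
qed

section \<open>The Levi-Civita connection in a chart\<close>

text \<open>\<open>w\<close> solves a linear system with differentiable coefficients. Instead of
  inverting a matrix, its coordinates \<open>x\<close> in a basis orthonormal for \<open>G p\<close>
  are written as \<open>l\<close> plus a sum of products \<open>x c q * \<epsilon> a c q\<close>,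
  with \<open>\<epsilon>\<close> vanishing at \<open>p\<close>. A bootstrap shows them bounded, then
  continuous, then differentiable.\<close>

lemma differentiable_implicit_vector:
  fixes G :: "'q::real_normed_vector \<Rightarrow> 'a::euclidean_space \<Rightarrow> 'a \<Rightarrow> real"
  assumes S: "open S" "p \<in> S" and inner: "\<And>q. q \<in> S \<Longrightarrow> inner_form (G q)"
    and dG: "\<And>a b. (\<lambda>q. G q a b) differentiable (at p)"
    and dl: "\<And>a. (\<lambda>q. l q a) differentiable (at p)"
    and w: "\<And>q z. q \<in> S \<Longrightarrow> G q (w q) z = l q z"
  shows "w differentiable (at p)"
proof -
  interpret P: inner_form "G p"
    using inner S by blast
  obtain B where B: "orthonormal_basis (G p) UNIV B"
    using P.onb_exists subspace_UNIV by blast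
  have fin: "finite B"
    using P.onb_finite[OF B] .
  define x where "x a q = G p (w q) a" for a q
  define \<epsilon> where "\<epsilon> a c q = G p c a - G q c a" for a c q
  have expand: "w q = (\<Sum>c\<in>B. x c q *\<^sub>R c)" for q
    unfolding x_def using P.onb_expand[OF B, of "w q"] by simp
  have eq: "x a q = l q a + (\<Sum>c\<in>B. x c q * \<epsilon> a c q)" if "q \<in> S" for a q
  proof -
    interpret Q: inner_form "G q"
      using inner that .
    have "l q a = (\<Sum>c\<in>B. x c q * G q c a)"
      unfolding w[OF that, symmetric] by (subst expand) (simp add: Q.sum_left Q.simps)
    moreover have "x a q = (\<Sum>c\<in>B. x c q * G p c a)"
      unfolding x_def[of a] by (subst expand) (simp add: P.sum_left P.simps)
    ultimately show ?thesis
      by (simp add: \<epsilon>_def right_diff_distrib sum_subtractf)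
  qed
  have nearS: "\<forall>\<^sub>F q in at p. q \<in> S"
    using S by (rule eventually_at_in_open')
  have d\<epsilon>: "\<epsilon> a c differentiable (at p)" for a c
    unfolding \<epsilon>_def using dG by (intro derivative_intros) auto
  have \<epsilon>0: "((\<lambda>q. \<epsilon> a c q) \<longlongrightarrow> 0) (at p)" for a c
    using differentiable_imp_continuous_within[OF d\<epsilon>[of a c]]
    by (simp add: continuous_within \<epsilon>_def[of _ _ p])
  have lc: "((\<lambda>q. l q a) \<longlongrightarrow> l p a) (at p)" for a
    using differentiable_imp_continuous_within[OF dl[of a]] by (simp add: continuous_within)
  \<comment> \<open>\<open>\<Lambda>\<close> exceeds the limit of the sum of the
    |\<open>l q a\<close>|, hence bounds that sum near \<open>p\<close>. The factor 2 below comes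
    from solving X \<le> \<Lambda> + X / 2.\<close>
  define \<Lambda> where "\<Lambda> = (\<Sum>a\<in>B. \<bar>l p a\<bar>) + 1"
  have bound: "\<forall>\<^sub>F q in at p. \<forall>a\<in>B. \<bar>x a q\<bar> \<le> 2 * \<Lambda>"
  proof -
    have "((\<lambda>q. \<Sum>a\<in>B. \<Sum>c\<in>B. \<bar>\<epsilon> a c q\<bar>) \<longlongrightarrow> (\<Sum>a\<in>B. \<Sum>c\<in>B. \<bar>0\<bar>)) (at p)"
      by (intro tendsto_intros \<epsilon>0)
    then have 1: "\<forall>\<^sub>F q in at p. (\<Sum>a\<in>B. \<Sum>c\<in>B. \<bar>\<epsilon> a c q\<bar>) < 1 / 2"
      by (rule order_tendstoD) simp
    have "((\<lambda>q. \<Sum>a\<in>B. \<bar>l q a\<bar>) \<longlongrightarrow> (\<Sum>a\<in>B. \<bar>l p a\<bar>)) (at p)"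
      by (intro tendsto_intros lc)
    then have 2: "\<forall>\<^sub>F q in at p. (\<Sum>a\<in>B. \<bar>l q a\<bar>) < \<Lambda>"
      by (rule order_tendstoD) (simp add: \<Lambda>_def)
    show ?thesis
      using 1 2 nearS
    proof eventually_elim
      case (elim q)
      define X where "X = (\<Sum>a\<in>B. \<bar>x a q\<bar>)"
      have le_X: "\<bar>x a q\<bar> \<le> X" if "a \<in> B" for a
        unfolding X_def using fin that by (intro member_le_sum) auto
      have X0: "0 \<le> X"
        unfolding X_def by (intro sum_nonneg) simp
      have "\<bar>x a q\<bar> \<le> \<bar>l q a\<bar> + (\<Sum>c\<in>B. X * \<bar>\<epsilon> a c q\<bar>)" for a
      proof -
        have "\<bar>\<Sum>c\<in>B. x c q * \<epsilon> a c q\<bar> \<le> (\<Sum>c\<in>B. \<bar>x c q * \<epsilon> a c q\<bar>)"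
          by (rule sum_abs)
        also have "\<dots> \<le> (\<Sum>c\<in>B. X * \<bar>\<epsilon> a c q\<bar>)"
          using le_X by (intro sum_mono) (simp add: abs_mult mult_right_mono)
        finally show ?thesis
          using eq[OF elim(3), of a] by linarith
      qed
      then have "X \<le> (\<Sum>a\<in>B. \<bar>l q a\<bar> + (\<Sum>c\<in>B. X * \<bar>\<epsilon> a c q\<bar>))"
        unfolding X_def by (rule sum_mono)
      also have "\<dots> = (\<Sum>a\<in>B. \<bar>l q a\<bar>) + X * (\<Sum>a\<in>B. \<Sum>c\<in>B. \<bar>\<epsilon> a c q\<bar>)"
        by (simp add: sum.distrib sum_distrib_left)
      also have "\<dots> \<le> \<Lambda> + X * (1 / 2)"
        using elim X0 by (intro add_mono mult_left_mono) auto
      finally have "X \<le> 2 * \<Lambda>"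
        by simp
      then show ?case
        using le_X by force
    qed
  qed
  have x\<epsilon>: "((\<lambda>q. x c q * \<epsilon> a c q) \<longlongrightarrow> 0) (at p)" if "c \<in> B" for a c
  proof (rule Lim_null_comparison)
    show "\<forall>\<^sub>F q in at p. norm (x c q * \<epsilon> a c q) \<le> 2 * \<Lambda> * \<bar>\<epsilon> a c q\<bar>"
      using bound by eventually_elim (use that in \<open>simp add: abs_mult mult_right_mono\<close>)
    show "((\<lambda>q. 2 * \<Lambda> * \<bar>\<epsilon> a c q\<bar>) \<longlongrightarrow> 0) (at p)"
      using tendsto_mult_right_zero[OF tendsto_rabs_zero[OF \<epsilon>0]] .
  qed
  have x_p: "x a p = l p a" for a
    using w[OF S(2)] by (simp add: x_def)
  have cont: "isCont (x a) p" for a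
  proof -
    have "((\<lambda>q. l q a + (\<Sum>c\<in>B. x c q * \<epsilon> a c q)) \<longlongrightarrow> l p a + (\<Sum>c\<in>B. 0)) (at p)"
      by (intro tendsto_intros lc x\<epsilon>)
    moreover have "\<forall>\<^sub>F q in at p. l q a + (\<Sum>c\<in>B. x c q * \<epsilon> a c q) = x a q"
      using nearS by eventually_elim (rule eq[symmetric])
    ultimately have "(x a \<longlongrightarrow> l p a + (\<Sum>c\<in>B. 0)) (at p)"
      by (rule Lim_transform_eventually)
    then show ?thesis
      by (simp add: isCont_def x_p)
  qed
  \<comment> \<open>Last stage of the bootstrap: continuity of \<open>x\<close> suffices to
    differentiate the products, since \<open>\<epsilon>\<close> vanishes at
    \<open>p\<close>.\<close>
  have "x a differentiable (at p)" for a
  proof -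
    have "((\<lambda>q. x c q * \<epsilon> a c q) has_derivative (\<lambda>h. x c p * dir_deriv (\<epsilon> a c) p h)) (at p)" for c
      using d\<epsilon>[of a c] by (intro has_derivative_mult_vanishing cont) (simp_all add: frechet_derivative_works \<epsilon>_def[of _ _ p])
    then have "(\<lambda>q. x c q * \<epsilon> a c q) differentiable (at p)" for c
      by (rule differentiableI)
    then have "(\<lambda>q. l q a + (\<Sum>c\<in>B. x c q * \<epsilon> a c q)) differentiable (at p)"
      using dl fin by (intro derivative_intros) auto
    then obtain D where "((\<lambda>q. l q a + (\<Sum>c\<in>B. x c q * \<epsilon> a c q)) has_derivative D) (at p)"
      by (auto simp: differentiable_def)
    then have "(x a has_derivative D) (at p)"
      using S by (rule has_derivative_transform_within_open) (simp add: eq)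
    then show ?thesis
      by (rule differentiableI)
  qed
  then show ?thesis
    by (subst expand[abs_def]) (intro derivative_intros fin ballI)
qed

text \<open>Two derivatives of the coefficients are all that the curvature involves. Asking for no
  more lets a pulled-back metric be an instance without a proof that it is smooth.\<close>

locale chart_metric =
  fixes S :: "'e::euclidean_space set" and G :: "'e \<Rightarrow> 'e \<Rightarrow> 'e \<Rightarrow> real"
  assumes open_S: "open S" and inner: "q \<in> S \<Longrightarrow> inner_form (G q)"
    and diff1: "q \<in> S \<Longrightarrow> (\<lambda>q. G q a b) differentiable (at q)"
    and diff2: "q \<in> S \<Longrightarrow> (\<lambda>q. dir_deriv (\<lambda>q. G q a b) q u) differentiable (at q)"
begin

abbreviation dG :: "'e \<Rightarrow> 'e \<Rightarrow> 'e \<Rightarrow> 'e \<Rightarrow> real" where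
  "dG q u a b \<equiv> dir_deriv (\<lambda>q. G q a b) q u"

abbreviation \<Gamma> :: "'e \<Rightarrow> 'e \<Rightarrow> 'e \<Rightarrow> 'e" where
  "\<Gamma> \<equiv> christoffel G"

lemma bilinear_G: "q \<in> S \<Longrightarrow> bilinear (G q)"
  using inner by (rule inner_form.bilin)

lemma bilinear_dG: "q \<in> S \<Longrightarrow> bilinear (dG q u)"
  using bilinear_dir_deriv[OF open_S, where B = G] bilinear_G diff1 by blast

lemma linear_dG: "q \<in> S \<Longrightarrow> linear (\<lambda>u. dG q u a b)"
  using linear_frechet_derivative[OF diff1] .

lemma dG_sym: "q \<in> S \<Longrightarrow> dG q u a b = dG q u b a"
  using frechet_derivative_transform_within_open[OF diff1[of q a b] open_S, of "\<lambda>q. G q b a"]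
    inner_form.sym[OF inner] by metis

lemma koszul:
  assumes q: "q \<in> S"
  shows "2 * G q (\<Gamma> q u v) z = dG q u v z + dG q v u z - dG q z u v"
proof -
  interpret inner_form "G q"
    using inner q .
  have lin: "linear (\<lambda>z. dG q u v z)" for u v
    using bilinear_dG[OF q] by (simp add: bilinear_def)
  have "linear (\<lambda>z. (1 / 2) *\<^sub>R (dG q u v z + dG q v u z - dG q z u v))"
    by (intro linear_compose_scale_right linear_compose_sub linear_compose_add lin linear_dG[OF q])
  from ex1_riesz[OF this]
  have "\<exists>!w. \<forall>z. 2 * G q w z = dG q u v z + dG q v u z - dG q z u v"
    by (simp add: field_simps)
  from theI'[OF this] show ?thesis
    unfolding christoffel_def by blast
qed

text \<open>Nondegeneracy makes the Koszul formula determine the vector; symmetry and linearity of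
  the Christoffel map are read off from this.\<close>

lemma \<Gamma>_eqI:
  assumes q: "q \<in> S" and w: "\<And>z. 2 * G q w z = dG q u v z + dG q v u z - dG q z u v"
  shows "\<Gamma> q u v = w"
  using inner_form.eqI[OF inner[OF q], of "\<Gamma> q u v" w] koszul[OF q] w by (metis mult_cancel_left zero_neq_numeral)

lemma \<Gamma>_sym: "q \<in> S \<Longrightarrow> \<Gamma> q u v = \<Gamma> q v u"
  using dG_sym koszul by (intro \<Gamma>_eqI) simp_all

lemma bilinear_\<Gamma>:
  assumes q: "q \<in> S"
  shows "bilinear (\<Gamma> q)"
proof -
  interpret inner_form "G q"
    using inner q .
  note dG_simps = bilinear_ladd[OF bilinear_dG[OF q]] bilinear_radd[OF bilinear_dG[OF q]]
    bilinear_lmul[OF bilinear_dG[OF q]] bilinear_rmul[OF bilinear_dG[OF q]]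
    linear_add[OF linear_dG[OF q]] linear_scale[OF linear_dG[OF q]]
  have "linear (\<lambda>u. \<Gamma> q u v)" for v
    by (rule linearI; rule \<Gamma>_eqI[OF q])
      (simp_all add: simps distrib_left koszul[OF q] dG_simps mult.left_commute[of 2] algebra_simps)
  moreover have "(\<lambda>u. \<Gamma> q u v) = \<Gamma> q v" for v
    using \<Gamma>_sym[OF q] by blast
  ultimately show ?thesis
    unfolding bilinear_def by metis
qed

lemma differentiable_\<Gamma>:
  assumes q: "q \<in> S"
  shows "(\<lambda>q. \<Gamma> q u v) differentiable (at q)"
proof (rule differentiable_implicit_vector[OF open_S q inner diff1[OF q]])
  show "G q (\<Gamma> q u v) z = (dG q u v z + dG q v u z - dG q z u v) / 2" if "q \<in> S" for q z
    using koszul[OF that, of u v z] by simp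
  show "(\<lambda>q. (dG q u v z + dG q v u z - dG q z u v) / 2) differentiable (at q)" for z
    by (intro differentiable_divide differentiable_diff differentiable_add diff2[OF q] differentiable_const) simp
qed

text \<open>Adding the Koszul formulas for (u, v; z) and (u, z; v) cancels the derivatives in the
  directions \<open>v\<close> and \<open>z\<close>.\<close>

lemma metric_compatible:
  assumes q: "q \<in> S"
  shows "dG q u v z = G q (\<Gamma> q u v) z + G q v (\<Gamma> q u z)"
  using koszul[OF q, of u v z] koszul[OF q, of u z v] dG_sym[OF q, of v z u]
    inner_form.sym[OF inner[OF q], of v "\<Gamma> q u z"]
  by linarith

text \<open>Constant fields have vanishing bracket, and their covariant derivatives are pure
  Christoffel terms.\<close>

lemma curvature_op_const:
  "curvature_op G (\<lambda>_. u) (\<lambda>_. v) (\<lambda>_. w) q =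
    dir_deriv (\<lambda>q. \<Gamma> q v w) q u + \<Gamma> q u (\<Gamma> q v w) - (dir_deriv (\<lambda>q. \<Gamma> q u w) q v + \<Gamma> q v (\<Gamma> q u w))"
  if "q \<in> S"
  using bilinear_lzero[OF bilinear_\<Gamma>[OF that]]
  by (simp add: curvature_op_def nabla_def lie_bracket_def)

lemma bilinear_d\<Gamma>: "q \<in> S \<Longrightarrow> bilinear (\<lambda>v w. dir_deriv (\<lambda>q. \<Gamma> q v w) q u)"
  using bilinear_dir_deriv[OF open_S, where B = \<Gamma>] bilinear_\<Gamma> differentiable_\<Gamma> by blast

lemma quadrilinear_curvature:
  assumes q: "q \<in> S"
  shows "quadrilinear (\<lambda>u v w z. G q (curvature_op G (\<lambda>_. u) (\<lambda>_. v) (\<lambda>_. w) q) z)"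
proof -
  interpret inner_form "G q"
    using inner q .
  have lin\<Gamma>: "linear (\<lambda>u. \<Gamma> q u v)" "linear (\<Gamma> q v)" for v
    using bilinear_\<Gamma>[OF q] by (auto simp: bilinear_def)
  have lind\<Gamma>: "linear (\<lambda>v. dir_deriv (\<lambda>q. \<Gamma> q v w) q u)" "linear (\<lambda>w. dir_deriv (\<lambda>q. \<Gamma> q v w) q u)"
    "linear (\<lambda>u. dir_deriv (\<lambda>q. \<Gamma> q v w) q u)" for u v w
    using bilinear_d\<Gamma>[OF q] linear_frechet_derivative[OF differentiable_\<Gamma>[OF q]] by (auto simp: bilinear_def)
  have lin\<Gamma>\<Gamma>: "linear (\<lambda>u. \<Gamma> q v (\<Gamma> q u w))" "linear (\<lambda>u. \<Gamma> q v (\<Gamma> q w u))" for v w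
    using linear_compose[OF lin\<Gamma>(1)[of w] lin\<Gamma>(2)[of v]] linear_compose[OF lin\<Gamma>(2)[of w] lin\<Gamma>(2)[of v]]
    by (simp_all add: o_def)
  let ?R = "\<lambda>u v w. curvature_op G (\<lambda>_. u) (\<lambda>_. v) (\<lambda>_. w) q"
  have R: "linear (\<lambda>u. ?R u v w)" "linear (\<lambda>v. ?R u v w)" "linear (\<lambda>w. ?R u v w)" for u v w
    unfolding curvature_op_const[OF q]
    by (intro linear_compose_sub linear_compose_add lin\<Gamma> lind\<Gamma> lin\<Gamma>\<Gamma>)+
  show ?thesis
    unfolding quadrilinear_def
    using linear_compose[OF R(1) linear_left] linear_compose[OF R(2) linear_left]
      linear_compose[OF R(3) linear_left] linear_right
    by (auto simp: o_def)
qed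

end

section \<open>The Gauss equation in a chart\<close>

lemma differentiable_bilinear_along:
  fixes B :: "'e::real_normed_vector \<Rightarrow> 'a::euclidean_space \<Rightarrow> 'b::euclidean_space \<Rightarrow> 'c::real_normed_vector"
    and f :: "'f::real_normed_vector \<Rightarrow> 'e"
  assumes "open S" "f q \<in> S" "\<And>y. y \<in> S \<Longrightarrow> bilinear (B y)"
    and "\<And>a b. (\<lambda>y. B y a b) differentiable (at (f q))"
    and "f differentiable (at q)" "W1 differentiable (at q)" "W2 differentiable (at q)"
  shows "(\<lambda>q. B (f q) (W1 q) (W2 q)) differentiable (at q)"
  using has_derivative_bilinear_along[OF assms(1-4) assms(5-7)[unfolded frechet_derivative_works]]
  by (rule differentiableI)

text \<open>The coordinate picture of an immersion, with \<open>g\<close> the pull-back of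
  \<open>G\<close>. Derivatives of \<open>g\<close> are to be obtained from those of
  \<open>G\<close> and \<open>f\<close>.\<close>

locale immersed_chart = amb: chart_metric S G
  for S :: "'e::euclidean_space set" and G :: "'e \<Rightarrow> 'e \<Rightarrow> 'e \<Rightarrow> real" +
  fixes U :: "'f::euclidean_space set" and f :: "'f \<Rightarrow> 'e" and g :: "'f \<Rightarrow> 'f \<Rightarrow> 'f \<Rightarrow> real"
  assumes open_U: "open U" and smooth_f: "smooth_on U f" and f_in_S: "q \<in> U \<Longrightarrow> f q \<in> S"
    and inj_df: "q \<in> U \<Longrightarrow> inj (dir_deriv f q)"
    and g_eq: "q \<in> U \<Longrightarrow> g q u v = G (f q) (dir_deriv f q u) (dir_deriv f q v)"
begin

abbreviation df :: "'f \<Rightarrow> 'f \<Rightarrow> 'e" where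
  "df \<equiv> dir_deriv f"

abbreviation d2f :: "'f \<Rightarrow> 'f \<Rightarrow> 'f \<Rightarrow> 'e" where
  "d2f u v q \<equiv> dir_deriv (\<lambda>q. df q v) q u"

text \<open>The Hessian of the map \<open>f\<close>, called A(u, v) in the overview;
  \<open>v\<close> is extended as a constant field, as in \<open>second_ff\<close>.\<close>

definition hess :: "'f \<Rightarrow> 'f \<Rightarrow> 'f \<Rightarrow> 'e" where
  "hess u v q = cov_along G f (\<lambda>q. df q v) q u"

lemma hess_eq: "hess u v q = d2f u v q + amb.\<Gamma> (f q) (df q u) (df q v)"
  by (simp add: hess_def cov_along_def)

lemmas smooth_df = smooth_on_dir_deriv[OF smooth_f]
lemmas smooth_d2f = smooth_on_dir_deriv[OF smooth_df]

lemma linear_df: "q \<in> U \<Longrightarrow> linear (df q)"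
  using linear_frechet_derivative[OF smooth_on_differentiable[OF smooth_f]] .

lemma d2f_sym: "q \<in> U \<Longrightarrow> d2f u v q = d2f v u q"
  using dir_deriv_commute[OF smooth_f open_U] .

lemma hess_sym: "q \<in> U \<Longrightarrow> hess u v q = hess v u q"
  unfolding hess_eq using d2f_sym[of q u v] amb.\<Gamma>_sym[OF f_in_S, of q "df q u" "df q v"] by simp

lemma inner_G: "q \<in> U \<Longrightarrow> inner_form (G (f q))"
  using amb.inner f_in_S by blast

text \<open>Metric compatibility of the pull-back connection: the derivative of \<open>G\<close>
  along \<open>f\<close> is absorbed into the Christoffel terms of \<open>cov_along\<close>.\<close>

lemma G_along_has_derivative:
  assumes q: "q \<in> U" and W: "W1 differentiable (at q)" "W2 differentiable (at q)"
  shows "((\<lambda>q. G (f q) (W1 q) (W2 q)) has_derivative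
    (\<lambda>u. G (f q) (cov_along G f W1 q u) (W2 q) + G (f q) (W1 q) (cov_along G f W2 q u))) (at q)"
proof -
  interpret inner_form "G (f q)"
    using inner_G q .
  have "((\<lambda>q. G (f q) (W1 q) (W2 q)) has_derivative
    (\<lambda>u. amb.dG (f q) (df q u) (W1 q) (W2 q) + G (f q) (dir_deriv W1 q u) (W2 q) +
      G (f q) (W1 q) (dir_deriv W2 q u))) (at q)"
    using q W amb.open_S f_in_S amb.bilinear_G amb.diff1 smooth_on_differentiable[OF smooth_f q]
    by (intro has_derivative_bilinear_along[where S = S]) (auto simp: frechet_derivative_works)
  moreover have "amb.dG (f q) (df q u) (W1 q) (W2 q) + G (f q) (dir_deriv W1 q u) (W2 q) +
      G (f q) (W1 q) (dir_deriv W2 q u) =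
      G (f q) (cov_along G f W1 q u) (W2 q) + G (f q) (W1 q) (cov_along G f W2 q u)" for u
    using amb.metric_compatible[OF f_in_S[OF q], of "W1 q" "W2 q" "df q u"]
    by (simp add: cov_along_def simps)
  ultimately show ?thesis
    by simp
qed

lemma g_has_derivative:
  assumes q: "q \<in> U"
  shows "((\<lambda>q. g q a b) has_derivative
    (\<lambda>u. G (f q) (hess u a q) (df q b) + G (f q) (df q a) (hess u b q))) (at q)"
  unfolding hess_def
  using G_along_has_derivative[OF q smooth_on_differentiable[OF smooth_df q] smooth_on_differentiable[OF smooth_df q]]
  by (rule has_derivative_transform_within_open[OF _ open_U q]) (simp add: g_eq)

lemma dg_eq: "q \<in> U \<Longrightarrow> dir_deriv (\<lambda>q. g q a b) q u = G (f q) (hess u a q) (df q b) + G (f q) (df q a) (hess u b q)"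
  using fun_cong[OF frechet_derivative_at[OF g_has_derivative[of q a b]], of u] by simp

lemma hess_differentiable:
  assumes q: "q \<in> U"
  shows "hess v w differentiable (at q)"
proof -
  have "(\<lambda>q. amb.\<Gamma> (f q) (df q v) (df q w)) differentiable (at q)"
    using differentiable_bilinear_along[where B = amb.\<Gamma>, OF amb.open_S f_in_S[OF q] amb.bilinear_\<Gamma>
        amb.differentiable_\<Gamma>[OF f_in_S[OF q]] smooth_on_differentiable[OF smooth_f q]
        smooth_on_differentiable[OF smooth_df q] smooth_on_differentiable[OF smooth_df q]] .
  then show ?thesis
    unfolding hess_eq[abs_def] using smooth_on_differentiable[OF smooth_d2f q]
    by (intro differentiable_add)
qed

lemma inner_g:
  assumes q: "q \<in> U"
  shows "inner_form (g q)"
proof -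
  interpret inner_form "G (f q)"
    using inner_G q .
  have *: "g q = (\<lambda>u v. G (f q) (df q u) (df q v))"
    using g_eq[OF q] by blast
  show ?thesis
  proof
    show "bilinear (g q)"
      unfolding * bilinear_def
      using linear_compose[OF linear_df[OF q] linear_left] linear_compose[OF linear_df[OF q] linear_right]
      by (simp add: o_def)
    show "g q u v = g q v u" for u v
      unfolding * by (rule sym)
    show "0 < g q u u" if "u \<noteq> 0" for u
      unfolding * using that linear_injective_0[OF linear_df[OF q]] inj_df[OF q] by (intro pos) blast
  qed
qed

text \<open>By \<open>dg_eq\<close> the first derivatives of \<open>g\<close> are ambient pairings
  of \<open>hess\<close> with \<open>df\<close>. Both are differentiable along \<open>f\<close>, so
  second derivatives exist, and the Christoffel map and curvature of \<open>g\<close> become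
  available.\<close>

sublocale dom: chart_metric U g
proof (rule chart_metric.intro)
  fix q a b u assume q: "q \<in> U"
  show "(\<lambda>q. g q a b) differentiable (at q)"
    using g_has_derivative[OF q] by (rule differentiableI)
  have G_along: "(\<lambda>q. G (f q) (W1 q) (W2 q)) differentiable (at q)"
    if "W1 differentiable (at q)" "W2 differentiable (at q)" for W1 W2
    using G_along_has_derivative[OF q that] by (rule differentiableI)
  have "(\<lambda>q. G (f q) (hess u a q) (df q b) + G (f q) (df q a) (hess u b q)) differentiable (at q)"
    by (intro differentiable_add G_along hess_differentiable[OF q] smooth_on_differentiable[OF smooth_df q])
  then obtain D where "((\<lambda>q. G (f q) (hess u a q) (df q b) + G (f q) (df q a) (hess u b q)) has_derivative D) (at q)"
    by (auto simp: differentiable_def)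
  then have "((\<lambda>q. dir_deriv (\<lambda>q. g q a b) q u) has_derivative D) (at q)"
    by (rule has_derivative_transform_within_open[OF _ open_U q]) (simp add: dg_eq)
  then show "(\<lambda>q. dir_deriv (\<lambda>q. g q a b) q u) differentiable (at q)"
    by (rule differentiableI)
qed (fact open_U inner_g)+

text \<open>Inserting \<open>dg_eq\<close> into the Koszul formula for \<open>g\<close> gives six
  terms, four of which cancel by symmetry of \<open>hess\<close>.\<close>

lemma hess_tangential:
  assumes q: "q \<in> U"
  shows "G (f q) (hess u v q) (df q z) = g q (dom.\<Gamma> q u v) z"
proof -
  note sym = inner_form.sym[OF inner_G[OF q]]
  have "2 * g q (dom.\<Gamma> q u v) z = 2 * G (f q) (hess u v q) (df q z)"
    unfolding dom.koszul[OF q] dg_eq[OF q]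
    using hess_sym[OF q, of v u] hess_sym[OF q, of z u] hess_sym[OF q, of z v]
      sym[of "df q v" "hess u z q"] sym[of "df q u" "hess v z q"]
    by simp
  then show ?thesis by simp
qed

lemma hess_has_derivative:
  assumes q: "q \<in> U"
  shows "(hess v w has_derivative (\<lambda>u. dir_deriv (d2f v w) q u +
    (dir_deriv (\<lambda>y. amb.\<Gamma> y (df q v) (df q w)) (f q) (df q u) +
     amb.\<Gamma> (f q) (d2f u v q) (df q w) + amb.\<Gamma> (f q) (df q v) (d2f u w q)))) (at q)"
  unfolding hess_eq[abs_def]
proof (rule has_derivative_add)
  show "(d2f v w has_derivative dir_deriv (d2f v w) q) (at q)"
    using smooth_on_has_derivative[OF smooth_d2f q] .
  show "((\<lambda>q. amb.\<Gamma> (f q) (df q v) (df q w)) has_derivative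
    (\<lambda>u. dir_deriv (\<lambda>y. amb.\<Gamma> y (df q v) (df q w)) (f q) (df q u) +
     amb.\<Gamma> (f q) (d2f u v q) (df q w) + amb.\<Gamma> (f q) (df q v) (d2f u w q))) (at q)"
    using has_derivative_bilinear_along[where B = amb.\<Gamma>, OF amb.open_S f_in_S[OF q] amb.bilinear_\<Gamma>
        amb.differentiable_\<Gamma>[OF f_in_S[OF q]] smooth_on_has_derivative[OF smooth_f q]
        smooth_on_has_derivative[OF smooth_df q] smooth_on_has_derivative[OF smooth_df q]] .
qed

text \<open>The curvature of the pull-back connection on the field df(w). Third derivatives of
  \<open>f\<close> commute and cancel; the Christoffel terms containing a second derivative of
  \<open>f\<close> are together symmetric in \<open>u\<close> and \<open>v\<close> and cancel
  too.\<close>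

lemma cov_along_hess_commutator:
  assumes q: "q \<in> U"
  shows "cov_along G f (hess v w) q u - cov_along G f (hess u w) q v =
    curvature_op G (\<lambda>_. df q u) (\<lambda>_. df q v) (\<lambda>_. df q w) (f q)"
proof -
  note \<Gamma>_simps = bilinear_radd[OF amb.bilinear_\<Gamma>[OF f_in_S[OF q]]]
  have "dir_deriv (d2f v w) q u = dir_deriv (d2f u w) q v"
    using dir_deriv_commute[OF smooth_df open_U q] .
  moreover have "dir_deriv (hess v w) q u = dir_deriv (d2f v w) q u +
    (dir_deriv (\<lambda>y. amb.\<Gamma> y (df q v) (df q w)) (f q) (df q u) +
     amb.\<Gamma> (f q) (d2f u v q) (df q w) + amb.\<Gamma> (f q) (df q v) (d2f u w q))" for u v
    using fun_cong[OF frechet_derivative_at[OF hess_has_derivative[OF q, of v w]], of u] by simp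
  ultimately show ?thesis
    unfolding amb.curvature_op_const[OF f_in_S[OF q]] cov_along_def hess_eq
    using d2f_sym[OF q, of u v] by (simp add: \<Gamma>_simps)
qed

text \<open>\<open>hess_tangential\<close> is differentiated in direction \<open>u\<close>, with
  compatibility of \<open>G\<close> on the left and of \<open>g\<close> on the right. The product
  rule on the left leaves the term <A(v,w), A(u,z)>.\<close>

lemma cov_along_hess_tangential:
  assumes q: "q \<in> U"
  shows "G (f q) (cov_along G f (hess v w) q u) (df q z) =
    g q (dir_deriv (\<lambda>q. dom.\<Gamma> q v w) q u + dom.\<Gamma> q u (dom.\<Gamma> q v w)) z +
    g q (dom.\<Gamma> q v w) (dom.\<Gamma> q u z) - G (f q) (hess v w q) (hess u z q)"
proof -
  interpret gq: inner_form "g q"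
    using inner_g q .
  have "((\<lambda>q. G (f q) (hess v w q) (df q z)) has_derivative
      (\<lambda>u. G (f q) (cov_along G f (hess v w) q u) (df q z) + G (f q) (hess v w q) (hess u z q))) (at q)"
    using G_along_has_derivative[OF q hess_differentiable[OF q] smooth_on_differentiable[OF smooth_df q]]
    unfolding hess_def[of _ z] .
  then have 1: "((\<lambda>q. g q (dom.\<Gamma> q v w) z) has_derivative
      (\<lambda>u. G (f q) (cov_along G f (hess v w) q u) (df q z) + G (f q) (hess v w q) (hess u z q))) (at q)"
    by (rule has_derivative_transform_within_open[OF _ open_U q]) (rule hess_tangential)
  \<comment> \<open>The same function differentiated intrinsically; \<open>z\<close> is constant,
    whence the 0 in the last slot.\<close>
  have 2: "((\<lambda>q. g q (dom.\<Gamma> q v w) z) has_derivative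
      (\<lambda>u. dom.dG q u (dom.\<Gamma> q v w) z + g q (dir_deriv (\<lambda>q. dom.\<Gamma> q v w) q u) z +
        g q (dom.\<Gamma> q v w) 0)) (at q)"
    using has_derivative_bilinear_along[where B = g and S = U and f = "\<lambda>q. q", OF open_U q dom.bilinear_G
        dom.diff1[OF q] has_derivative_ident
        dom.differentiable_\<Gamma>[OF q, unfolded frechet_derivative_works] has_derivative_const[of z]] .
  have "G (f q) (cov_along G f (hess v w) q u) (df q z) + G (f q) (hess v w q) (hess u z q) =
      dom.dG q u (dom.\<Gamma> q v w) z + g q (dir_deriv (\<lambda>q. dom.\<Gamma> q v w) q u) z"
    using fun_cong[OF has_derivative_unique[OF 1 2], of u] by (simp add: gq.simps)
  then show ?thesis
    using dom.metric_compatible[OF q, of "dom.\<Gamma> q v w" z u] by (simp add: gq.simps)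
qed

definition second_form :: "'f \<Rightarrow> 'f \<Rightarrow> 'f \<Rightarrow> 'e" where
  "second_form q u v = normal_part (G (f q)) (range (df q)) (hess u v q)"

text \<open>\<open>hess_tangential\<close> makes this difference orthogonal to the range of
  \<open>df q\<close>, which characterises the normal part.\<close>

lemma second_form_eq:
  assumes q: "q \<in> U"
  shows "second_form q u v = hess u v q - df q (dom.\<Gamma> q u v)"
proof -
  interpret inner_form "G (f q)"
    using inner_G q .
  show ?thesis
    unfolding second_form_def
  proof (rule normal_part_eqI)
    show "subspace (range (df q))"
      using linear_subspace_image[OF linear_df[OF q] subspace_UNIV] .
    show "G (f q) (hess u v q - df q (dom.\<Gamma> q u v)) y = 0" if "y \<in> range (df q)" for y
      using that hess_tangential[OF q, of u v] g_eq[OF q] by (auto simp: simps)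
  qed simp
qed

lemma second_form_sym: "q \<in> U \<Longrightarrow> second_form q u v = second_form q v u"
  by (simp add: second_form_def hess_sym[of q u])

lemma second_form_normal:
  assumes q: "q \<in> U"
  shows "G (f q) (second_form q u v) (df q z) = 0"
  unfolding second_form_def
  using inner_form.normal_part(1)[OF inner_G[OF q] linear_subspace_image[OF linear_df[OF q] subspace_UNIV]]
  by blast

lemma bilinear_second_form:
  assumes q: "q \<in> U"
  shows "bilinear (second_form q)"
proof -
  interpret inner_form "G (f q)"
    using inner_G q .
  have "linear (\<lambda>u. hess u v q)" for v
  proof -
    have "linear (\<lambda>x. amb.\<Gamma> (f q) x (df q v))"
      using amb.bilinear_\<Gamma>[OF f_in_S[OF q]] by (simp add: bilinear_def)
    from linear_compose[OF linear_df[OF q] this]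
    show ?thesis
      unfolding hess_eq using linear_frechet_derivative[OF smooth_on_differentiable[OF smooth_df q]]
      by (intro linear_compose_add) (simp_all add: o_def)
  qed
  from linear_compose[OF this linear_normal_part[OF linear_subspace_image[OF linear_df[OF q] subspace_UNIV]]]
  have "linear (\<lambda>u. second_form q u v)" for v
    by (simp add: second_form_def o_def)
  moreover have "(\<lambda>u. second_form q u v) = second_form q v" for v
    using second_form_sym[OF q] by blast
  ultimately show ?thesis
    unfolding bilinear_def by metis
qed

theorem gauss_equation:
  assumes q: "q \<in> U"
  shows "g q (curvature_op g (\<lambda>_. u) (\<lambda>_. v) (\<lambda>_. w) q) z =
    G (f q) (curvature_op G (\<lambda>_. df q u) (\<lambda>_. df q v) (\<lambda>_. df q w) (f q)) (df q z) +
    G (f q) (second_form q v w) (second_form q u z) - G (f q) (second_form q u w) (second_form q v z)"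
proof -
  interpret Gq: inner_form "G (f q)"
    using inner_G q .
  interpret gq: inner_form "g q"
    using inner_g q .
  have hess: "hess u v q = second_form q u v + df q (dom.\<Gamma> q u v)" for u v
    by (simp add: second_form_eq[OF q])
  \<comment> \<open>Normal and tangential parts are orthogonal. The intrinsic products split off
    here cancel the products of Christoffel vectors in \<open>cov_along_hess_tangential\<close>, so
    only \<open>second_form\<close> survives.\<close>
  have split: "G (f q) (hess u v q) (hess w z q) =
      G (f q) (second_form q u v) (second_form q w z) + g q (dom.\<Gamma> q u v) (dom.\<Gamma> q w z)" for u v w z
    unfolding hess g_eq[OF q]
    using second_form_normal[OF q] Gq.sym[of "df q _" "second_form q w z"] by (simp add: Gq.simps)
  show ?thesis
    unfolding cov_along_hess_commutator[OF q, symmetric] dom.curvature_op_const[OF q]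
    by (simp only: Gq.simps gq.simps cov_along_hess_tangential[OF q] split)
qed

end

section \<open>From charts to manifolds\<close>

lemma chart_inv_map: "is_chart c \<Longrightarrow> x \<in> chart_dom c \<Longrightarrow> chart_inv c (chart_map c x) = x"
  unfolding is_chart_def by (metis homeomorphism_apply1)

lemma chart_map_inv: "is_chart c \<Longrightarrow> p \<in> chart_map c ` chart_dom c \<Longrightarrow> chart_map c (chart_inv c p) = p"
  by (auto simp: chart_inv_map)

lemma open_chart_image:
  assumes c: "is_chart c" and W: "open W" "W \<subseteq> chart_dom c"
  shows "open (chart_map c ` W)"
proof -
  have "chart_map c ` W = chart_map c ` chart_dom c \<inter> chart_inv c -` W"
    using W chart_inv_map[OF c] by (auto simp: subset_iff)
  moreover have "open (chart_map c ` chart_dom c \<inter> chart_inv c -` W)"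
    using c W(1) unfolding is_chart_def homeomorphism_def by (intro continuous_open_preimage) auto
  ultimately show ?thesis by simp
qed

text \<open>With \<open>id\<close> for \<open>F\<close> this is a change of components, with the
  base charts it is \<open>differential\<close>; a single chain rule then covers all
  transitions.\<close>

definition loc_deriv :: "('m \<Rightarrow> 'n) \<Rightarrow> ('m, 'f::euclidean_space) chart \<Rightarrow> ('n, 'e::euclidean_space) chart
    \<Rightarrow> 'm \<Rightarrow> 'f \<Rightarrow> 'e" where
  "loc_deriv F b c x = dir_deriv (chart_map c \<circ> F \<circ> chart_inv b) (chart_map b x)"

lemma loc_deriv_compose:
  assumes b: "is_chart b" and c: "is_chart c" and op: "open {z \<in> chart_dom b. F z \<in> chart_dom c}"
    and x: "x \<in> chart_dom b" "F x \<in> chart_dom c"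
    and F: "(chart_map c \<circ> F \<circ> chart_inv b) differentiable (at (chart_map b x))"
    and G: "(chart_map e \<circ> G \<circ> chart_inv c) differentiable (at (chart_map c (F x)))"
  shows "loc_deriv (G \<circ> F) b e x u = loc_deriv G c e (F x) (loc_deriv F b c x u)"
proof -
  \<comment> \<open>On this open set the inner charts cancel in the composite of the two coordinate
    representations.\<close>
  let ?U = "chart_map b ` {z \<in> chart_dom b. F z \<in> chart_dom c}"
  have U: "open ?U" "chart_map b x \<in> ?U"
    using open_chart_image[OF b op] x by auto
  have eq: "(chart_map c \<circ> F \<circ> chart_inv b) (chart_map b x) = chart_map c (F x)"
    using x by (simp add: chart_inv_map[OF b])
  have "((chart_map e \<circ> G \<circ> chart_inv c) has_derivative loc_deriv G c e (F x))
      (at ((chart_map c \<circ> F \<circ> chart_inv b) (chart_map b x)))"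
    using G unfolding eq loc_deriv_def by (simp add: frechet_derivative_works)
  moreover have "((chart_map c \<circ> F \<circ> chart_inv b) has_derivative loc_deriv F b c x) (at (chart_map b x))"
    using F unfolding loc_deriv_def by (simp add: frechet_derivative_works)
  ultimately have "((chart_map e \<circ> G \<circ> chart_inv c) \<circ> (chart_map c \<circ> F \<circ> chart_inv b) has_derivative
      loc_deriv G c e (F x) \<circ> loc_deriv F b c x) (at (chart_map b x))"
    by (rule diff_chain_at[rotated])
  then have "((chart_map e \<circ> (G \<circ> F) \<circ> chart_inv b) has_derivative
      loc_deriv G c e (F x) \<circ> loc_deriv F b c x) (at (chart_map b x))"
    by (rule has_derivative_transform_within_open[OF _ U])
      (auto simp: chart_inv_map[OF b] chart_inv_map[OF c])
  then show ?thesis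
    unfolding loc_deriv_def[of "G \<circ> F"] by (simp add: frechet_derivative_at[symmetric])
qed

lemma loc_deriv_id:
  assumes c: "is_chart c" and x: "x \<in> chart_dom c"
  shows "loc_deriv id c c x u = u"
proof -
  have U: "open (chart_map c ` chart_dom c)" "chart_map c x \<in> chart_map c ` chart_dom c"
    using c x by (auto simp: is_chart_def)
  have "((chart_map c \<circ> id \<circ> chart_inv c) has_derivative (\<lambda>u. u)) (at (chart_map c x))"
    by (rule has_derivative_transform_within_open[OF has_derivative_ident U])
      (simp add: chart_map_inv[OF c])
  then show ?thesis
    unfolding loc_deriv_def by (simp add: frechet_derivative_at[symmetric])
qed

lemma smooth_manifold_chart: "smooth_manifold M \<Longrightarrow> c \<in> atlas M \<Longrightarrow> is_chart c"
  by (simp add: smooth_manifold_def)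

lemma smooth_manifold_chart_at:
  assumes "smooth_manifold M" "x \<in> points M"
  shows "chart_at M x \<in> atlas M" "x \<in> chart_dom (chart_at M x)"
  using assms by (auto simp: smooth_manifold_def)

lemma smooth_map_id: "smooth_manifold M \<Longrightarrow> smooth_map M M id"
proof -
  assume M: "smooth_manifold M"
  have *: "{x \<in> chart_dom b. id x \<in> chart_dom c} = chart_dom b \<inter> chart_dom c" for b c :: "('a, 'b) chart"
    by auto
  show ?thesis
    using M unfolding smooth_map_def * by (auto simp: smooth_manifold_def simp del: o_apply)
qed

lemma smooth_map_local:
  assumes F: "smooth_map M N F" and M: "smooth_manifold M" and N: "smooth_manifold N"
    and b: "b \<in> atlas M" and c: "c \<in> atlas N"
  defines "W \<equiv> {z \<in> chart_dom b. F z \<in> chart_dom c}"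
  shows "open W" "open (chart_map b ` W)" "smooth_on (chart_map b ` W) (chart_map c \<circ> F \<circ> chart_inv b)"
proof -
  have dom: "open (chart_dom b)" "open (chart_dom c)"
    using smooth_manifold_chart[OF M b] smooth_manifold_chart[OF N c] by (auto simp: is_chart_def)
  have "continuous_on (chart_dom b) F"
    using F b by (auto simp: smooth_map_def points_def intro: continuous_on_subset)
  from continuous_open_preimage[OF this dom]
  show "open W"
    by (simp add: W_def Int_def vimage_def)
  then show "open (chart_map b ` W)"
    using smooth_manifold_chart[OF M b] by (intro open_chart_image) (auto simp: W_def)
  show "smooth_on (chart_map b ` W) (chart_map c \<circ> F \<circ> chart_inv b)"
    using F b c by (simp add: smooth_map_def W_def)
qed

lemma loc_deriv_smooth_compose:
  assumes M: "smooth_manifold M" and N: "smooth_manifold N" and P: "smooth_manifold P"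
    and F: "smooth_map M N F" and G: "smooth_map N P G"
    and charts: "b \<in> atlas M" "c \<in> atlas N" "e \<in> atlas P"
    and x: "x \<in> chart_dom b" "F x \<in> chart_dom c" "G (F x) \<in> chart_dom e"
  shows "loc_deriv (G \<circ> F) b e x u = loc_deriv G c e (F x) (loc_deriv F b c x u)"
  using x
  by (intro loc_deriv_compose smooth_manifold_chart[OF M] smooth_manifold_chart[OF N] charts
      smooth_map_local(1)[OF F M N] smooth_on_differentiable[OF smooth_map_local(3)[OF F M N]]
      smooth_on_differentiable[OF smooth_map_local(3)[OF G N P]]) auto

lemma linear_loc_deriv:
  assumes "smooth_map M N F" "smooth_manifold M" "smooth_manifold N" "b \<in> atlas M" "c \<in> atlas N"
    "x \<in> chart_dom b" "F x \<in> chart_dom c"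
  shows "linear (loc_deriv F b c x)"
  unfolding loc_deriv_def
  using assms(6,7)
  by (intro linear_frechet_derivative smooth_on_differentiable[OF smooth_map_local(3)[OF assms(1-5)]]) auto

lemma of_comps_loc_deriv: "of_comps M c x = loc_deriv id c (chart_at M x) x"
  by (simp add: of_comps_def loc_deriv_def)

lemma differential_loc_deriv: "differential M N F x = loc_deriv F (chart_at M x) (chart_at N (F x)) x"
  by (simp add: differential_def local_rep_def loc_deriv_def base_coord_def)

lemma chart_dom_points: "c \<in> atlas M \<Longrightarrow> x \<in> chart_dom c \<Longrightarrow> x \<in> points M"
  by (auto simp: points_def)

text \<open>Injectivity: the passage from the chart at \<open>x\<close> back to \<open>c\<close> is
  a left inverse, by the chain rule for \<open>id\<close> composed with itself.\<close>

lemma of_comps_properties: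
  assumes M: "smooth_manifold M" and c: "c \<in> atlas M" "x \<in> chart_dom c"
  shows linear_of_comps: "linear (of_comps M c x)" and inj_of_comps: "inj (of_comps M c x)"
proof -
  note at = smooth_manifold_chart_at[OF M chart_dom_points[OF c]]
  show "linear (of_comps M c x)"
    unfolding of_comps_loc_deriv using at c by (intro linear_loc_deriv[OF smooth_map_id[OF M] M M]) simp_all
  have "loc_deriv id (chart_at M x) c x (of_comps M c x u) = u" for u
    using loc_deriv_smooth_compose[OF M M M smooth_map_id[OF M] smooth_map_id[OF M] c(1) at(1) c(1), of x u]
      c at loc_deriv_id[OF smooth_manifold_chart[OF M c(1)] c(2)]
    by (simp add: of_comps_loc_deriv)
  then show "inj (of_comps M c x)"
    by (metis injI)
qed

lemma of_comps_chart_at: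
  assumes "smooth_manifold M" "x \<in> points M"
  shows "of_comps M (chart_at M x) x u = u"
  unfolding of_comps_loc_deriv
  using smooth_manifold_chart_at[OF assms] smooth_manifold_chart[OF assms(1)] by (intro loc_deriv_id) auto

lemma metric_in_chart_map:
  assumes "smooth_manifold M" "c \<in> atlas M" "x \<in> chart_dom c"
  shows "metric_in M g c (chart_map c x) u v = g x (of_comps M c x u) (of_comps M c x v)"
  by (simp add: metric_in_def chart_inv_map[OF smooth_manifold_chart[OF assms(1,2)] assms(3)])

lemma metric_in_base_coord:
  assumes "smooth_manifold M" "x \<in> points M"
  shows "metric_in M g (chart_at M x) (base_coord M x) = g x"
  unfolding base_coord_def
  using metric_in_chart_map[OF assms(1) smooth_manifold_chart_at[OF assms]] of_comps_chart_at[OF assms]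
  by fastforce

lemma riemannian_inner_form:
  assumes "riemannian_metric M g" "x \<in> points M"
  shows "inner_form (g x)"
  using assms by unfold_locales (auto simp: riemannian_metric_def)

lemma chart_metric_metric_in:
  assumes M: "smooth_manifold M" and g: "riemannian_metric M g" and c: "c \<in> atlas M"
  shows "chart_metric (chart_map c ` chart_dom c) (metric_in M g c)"
proof (rule chart_metric.intro)
  show "open (chart_map c ` chart_dom c)"
    using smooth_manifold_chart[OF M c] by (simp add: is_chart_def)
  fix q assume q: "q \<in> chart_map c ` chart_dom c"
  have smooth: "smooth_on (chart_map c ` chart_dom c) (\<lambda>q. metric_in M g c q a b)" for a b
    using g c by (simp add: riemannian_metric_def)
  show "(\<lambda>q. metric_in M g c q a b) differentiable (at q)" for a b
    using smooth_on_differentiable[OF smooth q] .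
  show "(\<lambda>q. dir_deriv (\<lambda>q. metric_in M g c q a b) q u) differentiable (at q)" for a b u
    using smooth_on_differentiable[OF smooth_on_dir_deriv[OF smooth] q] .
  obtain x where x: "x \<in> chart_dom c" "q = chart_map c x"
    using q by blast
  interpret inner_form "g x"
    using riemannian_inner_form[OF g chart_dom_points[OF c x(1)]] .
  have eq: "metric_in M g c q = (\<lambda>u v. g x (of_comps M c x u) (of_comps M c x v))"
    using metric_in_chart_map[OF M c x(1)] x(2) by blast
  note lin = linear_of_comps[OF M c x(1)]
  show "inner_form (metric_in M g c q)"
  proof
    show "bilinear (metric_in M g c q)"
      unfolding eq bilinear_def
      using linear_compose[OF lin linear_left] linear_compose[OF lin linear_right] by (simp add: o_def)
    show "metric_in M g c q u v = metric_in M g c q v u" for u v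
      unfolding eq by (rule sym)
    show "0 < metric_in M g c q u u" if "u \<noteq> 0" for u
      unfolding eq using that linear_injective_0[OF lin] inj_of_comps[OF M c x(1)] by (intro pos) blast
  qed
qed

text \<open>The charts \<open>b\<close> and \<open>c\<close> belong to the fixed point
  \<open>x\<close> and its image. Nearby points have base charts of their own, and their tangent
  vectors are transported to these two.\<close>

locale immersion_data =
  fixes M :: "('m::{t2_space,second_countable_topology}, 'f::euclidean_space) manifold"
    and N :: "('n::{t2_space,second_countable_topology}, 'e::euclidean_space) manifold"
    and gbar :: "('n, 'e) metric_field" and F :: "'m \<Rightarrow> 'n" and x :: 'm
  assumes M: "smooth_manifold M" and N: "smooth_manifold N" and gbar: "riemannian_metric N gbar"
    and F: "immersion M N F" and x: "x \<in> points M"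
begin

abbreviation b where "b \<equiv> chart_at M x"
abbreviation c where "c \<equiv> chart_at N (F x)"
abbreviation W where "W \<equiv> {z \<in> chart_dom b. F z \<in> chart_dom c}"
abbreviation g where "g \<equiv> induced_metric M N gbar F"

lemma smooth_F: "smooth_map M N F"
  using F by (simp add: immersion_def)

lemma Fx: "F x \<in> points N"
  using smooth_F x by (auto simp: smooth_map_def)

lemmas chart_M = smooth_manifold_chart_at[OF M x]
lemmas chart_N = smooth_manifold_chart_at[OF N Fx]

text \<open>Both sides are the derivative of \<open>F\<close> from chart \<open>b\<close> to the
  base chart at \<open>F z\<close>, factored once as \<open>F\<close> after \<open>id\<close> and
  once as \<open>id\<close> after \<open>F\<close>.\<close>

lemma differential_of_comps:
  assumes z: "z \<in> W"
  shows "differential M N F z (of_comps M b z u) = of_comps N c (F z) (loc_deriv F b c z u)"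
proof -
  have zM: "z \<in> points M" and zN: "F z \<in> points N"
    using z chart_dom_points[OF chart_M(1)] chart_dom_points[OF chart_N(1)] by auto
  note z_at = smooth_manifold_chart_at[OF M zM] smooth_manifold_chart_at[OF N zN]
  have "loc_deriv (F \<circ> id) b (chart_at N (F z)) z u = differential M N F z (of_comps M b z u)"
    using loc_deriv_smooth_compose[OF M M N smooth_map_id[OF M] smooth_F chart_M(1) z_at(1) z_at(3), of z u] z z_at
    by (simp add: differential_loc_deriv of_comps_loc_deriv)
  moreover have "loc_deriv (id \<circ> F) b (chart_at N (F z)) z u = of_comps N c (F z) (loc_deriv F b c z u)"
    using loc_deriv_smooth_compose[OF M N N smooth_F smooth_map_id[OF N] chart_M(1) chart_N(1) z_at(3), of z u] z z_at
    by (simp add: of_comps_loc_deriv)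
  ultimately show ?thesis
    by simp
qed

lemma immersed: "immersed_chart (chart_map c ` chart_dom c) (metric_in N gbar c) (chart_map b ` W)
    (local_rep M N F x) (metric_in M g b)"
proof (intro immersed_chart.intro immersed_chart_axioms.intro chart_metric_metric_in[OF N gbar chart_N(1)])
  note loc = smooth_map_local[OF smooth_F M N chart_M(1) chart_N(1)]
  show "open (chart_map b ` W)"
    by (rule loc(2))
  show "smooth_on (chart_map b ` W) (local_rep M N F x)"
    unfolding local_rep_def by (rule loc(3))
  fix q assume "q \<in> chart_map b ` W"
  then obtain z where z: "z \<in> W" and q: "q = chart_map b z"
    by blast
  have lq: "local_rep M N F x q = chart_map c (F z)"
    using z by (simp add: local_rep_def q chart_inv_map[OF smooth_manifold_chart[OF M chart_M(1)]])
  show "local_rep M N F x q \<in> chart_map c ` chart_dom c"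
    using z by (simp add: lq)
  have dq: "dir_deriv (local_rep M N F x) q = loc_deriv F b c z"
    by (simp add: q local_rep_def loc_deriv_def)
  have zM: "z \<in> points M"
    using z chart_dom_points[OF chart_M(1)] by auto
  \<comment> \<open>The composite is the differential at \<open>z\<close> after an injective change
    of components; an injective composite has an injective inner factor.\<close>
  have "inj (\<lambda>u. of_comps N c (F z) (loc_deriv F b c z u))"
    unfolding differential_of_comps[OF z, symmetric]
    using inj_compose[of "differential M N F z" "of_comps M b z"] F zM z inj_of_comps[OF M chart_M(1)]
    by (simp add: immersion_def o_def)
  then show "inj (dir_deriv (local_rep M N F x) q)"
    unfolding dq by (simp add: inj_def)
  show "metric_in M g b q u v = metric_in N gbar c (local_rep M N F x q)
      (dir_deriv (local_rep M N F x) q u) (dir_deriv (local_rep M N F x) q v)" for u v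
    unfolding dq lq
    using z metric_in_chart_map[OF M chart_M(1), of z] metric_in_chart_map[OF N chart_N(1), of "F z"]
    by (simp add: q induced_metric_def differential_of_comps[OF z])
qed

interpretation I: immersed_chart "chart_map c ` chart_dom c" "metric_in N gbar c" "chart_map b ` W"
    "local_rep M N F x" "metric_in M g b"
  by (rule immersed)

lemma base_coord_mem: "base_coord M x \<in> chart_map b ` W"
  using chart_M chart_N by (simp add: base_coord_def)

lemma local_rep_base_coord: "local_rep M N F x (base_coord M x) = base_coord N (F x)"
  using chart_inv_map[OF smooth_manifold_chart[OF M chart_M(1)] chart_M(2)] by (simp add: local_rep_def base_coord_def)

lemma metric_N_base: "metric_in N gbar c (local_rep M N F x (base_coord M x)) = gbar (F x)"
  unfolding local_rep_base_coord by (rule metric_in_base_coord[OF N Fx])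

lemma metric_M_base: "metric_in M g b (base_coord M x) = g x"
  by (rule metric_in_base_coord[OF M x])

lemma second_ff_eq: "second_ff M N gbar F x u v = I.second_form (base_coord M x) u v"
  unfolding second_ff_def I.second_form_def I.hess_def metric_N_base differential_def by simp

text \<open>At the base point the metrics read in the charts are \<open>g x\<close> and
  \<open>gbar (F x)\<close> themselves, and \<open>curvature\<close> is computed in these very
  charts, so the coordinate Gauss equation needs no further transport.\<close>

lemma gauss_data: "gauss_data (g x) (gbar (F x)) (differential M N F x) (second_ff M N gbar F x)
    (\<lambda>u v w z. g x (curvature M g x u v w) z)
    (\<lambda>u v w z. gbar (F x) (curvature N gbar (F x) u v w) z)"
proof (intro gauss_data.intro gauss_data_axioms.intro)
  note p = base_coord_mem
  show "inner_form (g x)"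
    using I.inner_g[OF p] unfolding metric_M_base .
  show "inner_form (gbar (F x))"
    by (rule riemannian_inner_form[OF gbar Fx])
  show "linear (differential M N F x)"
    using I.linear_df[OF p] by (simp add: differential_def)
  show "g x u v = gbar (F x) (differential M N F x u) (differential M N F x v)" for u v
    by (simp add: induced_metric_def)
  have sf: "second_ff M N gbar F x = I.second_form (base_coord M x)"
    using second_ff_eq by blast
  show "bilinear (second_ff M N gbar F x)"
    unfolding sf by (rule I.bilinear_second_form[OF p])
  show "second_ff M N gbar F x u v = second_ff M N gbar F x v u" for u v
    unfolding sf by (rule I.second_form_sym[OF p])
  show "quadrilinear (\<lambda>u v w z. gbar (F x) (curvature N gbar (F x) u v w) z)"
    using I.amb.quadrilinear_curvature[OF I.f_in_S[OF p]]
    unfolding metric_N_base unfolding local_rep_base_coord curvature_def .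
  show "g x (curvature M g x u v w) z =
    gbar (F x) (curvature N gbar (F x) (differential M N F x u) (differential M N F x v) (differential M N F x w))
      (differential M N F x z) +
    gbar (F x) (second_ff M N gbar F x v w) (second_ff M N gbar F x u z) -
    gbar (F x) (second_ff M N gbar F x u w) (second_ff M N gbar F x v z)" for u v w z
    using I.gauss_equation[OF p, of u v w z]
    unfolding metric_N_base metric_M_base
    unfolding sf curvature_def differential_def local_rep_base_coord .
qed

end

lemma subspace_max_complex_dist:
  assumes "linear (differential M N F x)" "linear (J (F x))"
  shows "subspace (max_complex_dist M N J F x)"
proof -
  have "subspace (J (F x) ` range (differential M N F x))"
    by (intro linear_subspace_image assms subspace_UNIV)
  from linear_subspace_vimage[OF assms(1) this] show ?thesis
    by (simp add: max_complex_dist_def vimage_def)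
qed

lemma mutual_curv_eq: "mutual_curv M g x k V = mutual_sum (g x) (\<lambda>u v w z. g x (curvature M g x u v w) z) k V"
  by (simp add: mutual_curv_def mutual_curv2_def mutual_sum_def mutual_def)

lemma mean_curv_eq: "mean_curv M N gbar F x V = onb_trace (induced_metric M N gbar F x) (second_ff M N gbar F x) V"
  by (simp add: mean_curv_def onb_trace_def)

text \<open>The interpretation of \<open>gauss_data\<close> at a point, with the maximal complex
  distribution as the subspace \<open>E\<close> of dimension d, reduces the claim to
  \<open>mutual_curvature_inequality\<close> by unfolding definitions.\<close>

theorem theorem1:
  fixes M :: "('m::{t2_space,second_countable_topology}, 'f::euclidean_space) manifold"
    and N :: "('n::{t2_space,second_countable_topology}, 'e::euclidean_space) manifold"
    and J :: "'n \<Rightarrow> 'e \<Rightarrow> 'e"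
    and gbar :: "('n, 'e) metric_field"
    and F :: "'m \<Rightarrow> 'n"
    and d l k s :: nat
    and n :: "nat \<Rightarrow> nat"
  assumes "almost_hermitian_manifold N J gbar"
    and "cr_submanifold M N J F d l"
    and "k \<ge> 2" and "\<forall>i<k. n i \<ge> 1" and "(\<Sum>i<k. n i) = s" and "s \<le> d"
  shows "\<forall>x\<in>points M.
     let g = induced_metric M N gbar F;
         D = max_complex_dist M N J F x;
         H = mean_curv M N gbar F x;
         norm_gbar = metric_norm gbar (F x);
         delta = delta_max_in M g x D k n;
         bound = delta_max N gbar (F x) k n + (real k - 1) / (2 * real k) *
           (if s < d then (max_mean_curv M N gbar F x D s)\<^sup>2 else (norm_gbar (H D))\<^sup>2)
     in delta \<le> bound \<and>
        (delta = bound \<longleftrightarrow>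
          (\<exists>V. orthogonal_subspaces (g x) D k n V \<and>
             mixed_totally_geodesic M N gbar F x k V \<and>
             (\<forall>i<k. \<forall>j<k. H (V i) = H (V j)) \<and>
             norm_gbar (H (span (\<Union>i<k. V i))) = max_mean_curv M N gbar F x D s \<and>
             mutual_curv N gbar (F x) k (\<lambda>i. differential M N F x ` V i)
               = delta_max N gbar (F x) k n))"
proof
  fix x assume x: "x \<in> points M"
  interpret immersion_data M N gbar F x
    using assms(1,2) x by unfold_locales (auto simp: almost_hermitian_manifold_def cr_submanifold_def)
  interpret gauss_data "g x" "gbar (F x)" "differential M N F x" "second_ff M N gbar F x"
    "\<lambda>u v w z. g x (curvature M g x u v w) z"
    "\<lambda>u v w z. gbar (F x) (curvature N gbar (F x) u v w) z"
    by (rule gauss_data)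
  let ?D = "max_complex_dist M N J F x"
  have "linear (J (F x))"
    using assms(1) Fx by (simp add: almost_hermitian_manifold_def smooth_endomorphism_field_def)
  then have D: "subspace ?D"
    by (rule subspace_max_complex_dist[OF linear_L])
  have dim: "dim ?D = d"
    using assms(2) x by (simp add: cr_submanifold_def)
  note main = mutual_curvature_inequality[OF D assms(3,5), unfolded dim, OF assms(6)]
  show "let g = induced_metric M N gbar F;
         D = max_complex_dist M N J F x;
         H = mean_curv M N gbar F x;
         norm_gbar = metric_norm gbar (F x);
         delta = delta_max_in M g x D k n;
         bound = delta_max N gbar (F x) k n + (real k - 1) / (2 * real k) *
           (if s < d then (max_mean_curv M N gbar F x D s)\<^sup>2 else (norm_gbar (H D))\<^sup>2)
     in delta \<le> bound \<and>
        (delta = bound \<longleftrightarrow>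
          (\<exists>V. orthogonal_subspaces (g x) D k n V \<and>
             mixed_totally_geodesic M N gbar F x k V \<and>
             (\<forall>i<k. \<forall>j<k. H (V i) = H (V j)) \<and>
             norm_gbar (H (span (\<Union>i<k. V i))) = max_mean_curv M N gbar F x D s \<and>
             mutual_curv N gbar (F x) k (\<lambda>i. differential M N F x ` V i)
               = delta_max N gbar (F x) k n))"
    unfolding Let_def delta_max_in_def max_mean_curv_def mutual_curv_eq mean_curv_eq metric_norm_def
      mixed_totally_geodesic_def
    using main by (rule conjI)
qed

end
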